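(* Let $d\ge 2$ and let $\gamma_d$ be the infimum of the set of all $\gamma\ge 0$ for which the equation $\exp(-\gamma(1-x)^d)=x$ has a solution $x<1$. Let $\delta>0$ and $0<c<\gamma_d$ be fixed and $p=\frac{c}{n}$. Then for $Y\in Y_d(n,p)$, $$\Pr\big[f_d(R_\infty(Y))>\delta n^d\big]=o(1)\quad (n\to\infty),$$ where $f_d(R_\infty(Y))$ is the number of $d$-simplices of $R_\infty(Y)$.
   Context: $\Delta_{n-1}$ denotes the $(n-1)$-simplex on vertex set $[n]$. $Y_d(n,p)$ is the probability space of complexes $\Delta_{n-1}^{(d-1)}\subset Y\subset\Delta_{n-1}^{(d)}$ in which each $d$-simplex is included independently with probability $p$. A $(d-1)$-simplex is a free face of $Y$ if it lies in exactly one $d$-simplex of $Y$; $R(Y)$ is obtained from $Y$ by removing all free $(d-1)$-faces together with the $d$-simplices containing them; $R_0(Y)=Y$, $R_i(Y)=R(R_{i-1}(Y))$, and $R_\infty(Y)$ is the eventual stable complex (obtained after performing all possible such collapse steps). *)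

theory Defs
  imports Complex_Main
begin

text \<open>A complex Y with full (d-1)-skeleton on vertex set [n] = {1..n} is determined by its
set F of d-simplices, each a (d+1)-element subset of {1..n}.\<close>

definition dsimplices :: "nat \<Rightarrow> nat \<Rightarrow> nat set set" where
  "dsimplices n d = {s. s \<subseteq> {1..n} \<and> card s = Suc d}"

definition free_face :: "nat set set \<Rightarrow> nat set \<Rightarrow> bool" where
  "free_face F \<sigma> \<longleftrightarrow> card {\<tau>\<in>F. \<sigma> \<subseteq> \<tau>} = 1"

definition collapse_step :: "nat \<Rightarrow> nat set set \<Rightarrow> nat set set" where
  "collapse_step d F = F - {\<tau>\<in>F. \<exists>\<sigma>. \<sigma> \<subseteq> \<tau> \<and> card \<sigma> = d \<and> free_face F \<sigma>}"

text \<open>d-simplices of R_infinity(Y): the eventual stable value of the decreasing sequence R_i.\<close>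
definition R_inf :: "nat \<Rightarrow> nat set set \<Rightarrow> nat set set" where
  "R_inf d F = (\<Inter>i. (collapse_step d ^^ i) F)"

definition prob_Yd :: "nat \<Rightarrow> nat \<Rightarrow> real \<Rightarrow> (nat set set \<Rightarrow> bool) \<Rightarrow> real" where
  "prob_Yd n d p P = (\<Sum>F\<in>Pow (dsimplices n d).
      if P F then p ^ card F * (1 - p) ^ (card (dsimplices n d) - card F) else 0)"

definition gamma_d :: "nat \<Rightarrow> real" where
  "gamma_d d = Inf {\<gamma>::real. \<gamma> \<ge> 0 \<and> (\<exists>x::real. x < 1 \<and> exp (- \<gamma> * (1 - x) ^ d) = x)}"

end

theory Submission
  imports Defs
begin

text \<open>
  By Markov's inequality it suffices to bound the probability that a fixed simplex \<open>\<tau>\<close> of \<open>Y\<close>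
  survives \<open>k\<close> rounds. If the \<open>k\<close>-neighbourhood of \<open>\<tau>\<close> contains no cycle, survival makes each
  facet of \<open>\<tau>\<close> the root of a tree of depth \<open>k\<close> in which every face has a further coface all of
  whose other facets continue (predicate \<open>surv\<close>). Its probability is at most \<open>q\<^sub>k + o(1)\<close>, where
  \<open>q\<^sub>0 = 1\<close> and \<open>q\<^sub>k\<^sub>+\<^sub>1 = 1 - exp (- c q\<^sub>k\<^sup>d)\<close> is the survival probability of a branching process:
  the failures of the different cofaces are decreasing events, so Harris' inequality bounds
  their conjunction from below, while the survivals of the \<open>d\<close> other facets of a coface are
  independent up to \<open>O(1/n)\<close>, the probability that their neighbourhoods meet. Since \<open>c < \<gamma>\<^sub>d\<close>,
  the limit of the decreasing sequence \<open>q\<^sub>k\<close>, a fixed point, must be \<open>0\<close>.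
\<close>

section \<open>Bernoulli random subsets\<close>

text \<open>Expectation over the random subset of \<open>E\<close> that contains each element
  independently with probability \<open>p\<close>. The weight is a product over coordinates, so that
  single coordinates can be split off or exchanged.\<close>

definition bexp :: "'a set \<Rightarrow> real \<Rightarrow> ('a set \<Rightarrow> real) \<Rightarrow> real" where
  "bexp E p f = (\<Sum>F\<in>Pow E. (\<Prod>e\<in>E. if e \<in> F then p else 1 - p) * f F)"

lemma bexp_empty [simp]: "bexp {} p f = f {}"
  by (simp add: bexp_def)

lemma bexp_insert:
  assumes "finite E" "e \<notin> E"
  shows "bexp (insert e E) p f = p * bexp E p (\<lambda>F. f (insert e F)) + (1 - p) * bexp E p f"
proof -
  have inj: "inj_on (insert e) (Pow E)"
    using assms(2) by (auto simp: inj_on_def)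
  have disj: "Pow E \<inter> insert e ` Pow E = {}"
    using assms(2) by auto
  have w1: "(\<Prod>x\<in>insert e E. if x \<in> insert e F then p else 1 - p)
      = p * (\<Prod>x\<in>E. if x \<in> F then p else 1 - p)" for F
    using assms by (auto intro!: prod.cong)
  have w0: "(\<Prod>x\<in>insert e E. if x \<in> F then p else 1 - p)
      = (1 - p) * (\<Prod>x\<in>E. if x \<in> F then p else 1 - p)" if "F \<subseteq> E" for F
    using assms that by (subst prod.insert) auto
  have s0: "(\<Sum>F\<in>Pow E. (\<Prod>x\<in>insert e E. if x \<in> F then p else 1 - p) * f F)
      = (1 - p) * bexp E p f"
    unfolding bexp_def sum_distrib_left by (intro sum.cong) (simp_all only: Pow_iff w0 mult.assoc)
  have s1: "(\<Sum>F\<in>insert e ` Pow E. (\<Prod>x\<in>insert e E. if x \<in> F then p else 1 - p) * f F)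
      = p * bexp E p (\<lambda>F. f (insert e F))"
    unfolding bexp_def sum_distrib_left sum.reindex[OF inj] o_def
    by (intro sum.cong) (simp_all only: w1 mult.assoc)
  show ?thesis
    using s0 s1 disj assms(1) unfolding bexp_def[of "insert e E"] Pow_insert
    by (subst sum.union_disjoint) auto
qed

lemma bexp_cong:
  assumes "\<And>F. F \<subseteq> E \<Longrightarrow> f F = g F"
  shows "bexp E p f = bexp E p g"
  using assms by (simp add: bexp_def)

lemma bexp_const:
  assumes "finite E"
  shows "bexp E p (\<lambda>_. k) = k"
  using assms by (induction E) (auto simp: bexp_insert algebra_simps)

lemma bexp_add: "bexp E p (\<lambda>F. f F + g F) = bexp E p f + bexp E p g"
  by (simp add: bexp_def sum.distrib distrib_left)

lemma bexp_diff: "bexp E p (\<lambda>F. f F - g F) = bexp E p f - bexp E p g"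
  by (simp add: bexp_def sum_subtractf right_diff_distrib)

lemma bexp_cmult: "bexp E p (\<lambda>F. k * f F) = k * bexp E p f"
  by (simp add: bexp_def sum_distrib_left mult.left_commute)

lemma bexp_multc: "bexp E p (\<lambda>F. f F * k) = bexp E p f * k"
  by (simp add: bexp_def sum_distrib_right mult.assoc)

lemma bexp_sum: "bexp E p (\<lambda>F. \<Sum>i\<in>I. f i F) = (\<Sum>i\<in>I. bexp E p (f i))"
  by (simp add: bexp_def sum_distrib_left sum.swap[of _ I])

lemma bexp_mono:
  assumes "0 \<le> p" "p \<le> 1" "\<And>F. F \<subseteq> E \<Longrightarrow> f F \<le> g F"
  shows "bexp E p f \<le> bexp E p g"
  unfolding bexp_def using assms
  by (intro sum_mono mult_left_mono prod_nonneg) auto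

lemma bexp_nonneg:
  assumes "0 \<le> p" "p \<le> 1" "\<And>F. F \<subseteq> E \<Longrightarrow> 0 \<le> f F"
  shows "0 \<le> bexp E p f"
  unfolding bexp_def using assms
  by (intro sum_nonneg mult_nonneg_nonneg prod_nonneg) auto

lemma bexp_le_1:
  assumes "finite E" "0 \<le> p" "p \<le> 1" "\<And>F. F \<subseteq> E \<Longrightarrow> f F \<le> 1"
  shows "bexp E p f \<le> 1"
  using bexp_mono[of p E f "\<lambda>_. 1"] assms by (simp add: bexp_const)

text \<open>After the coordinate \<open>e\<close> is split off, both branches see the same value of
  \<open>h\<close>, and only the weight of presence remains.\<close>

lemma bexp_indep:
  assumes "finite E" "e \<in> E"
  shows "bexp E p (\<lambda>F. of_bool (e \<in> F) * h (F - {e})) = p * bexp E p (\<lambda>F. h (F - {e}))"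
proof -
  obtain D where D: "E = insert e D" "e \<notin> D" "finite D"
    using assms by (metis Set.set_insert finite_insert)
  have 1: "bexp D p (\<lambda>F. of_bool (e \<in> F) * h (F - {e})) = bexp D p (\<lambda>_. 0)"
    using D by (intro bexp_cong) auto
  have 2: "bexp D p (\<lambda>F. h (F - {e})) = bexp D p h"
    using D by (intro bexp_cong arg_cong[of _ _ h]) auto
  have 3: "bexp D p (\<lambda>F. h (insert e F - {e})) = bexp D p h"
    using D by (intro bexp_cong arg_cong[of _ _ h]) auto
  show ?thesis
    using D 1 2 3 by (simp add: bexp_insert bexp_const algebra_simps del: insert_Diff_single Diff_insert0 insert_Diff_if)
qed

section \<open>Correlation and resampling for product measures\<close>

text \<open>Induction over the coordinates. The averages over the two values of a new coordinate are
  ordered the same way for \<open>f\<close> and \<open>g\<close>, so this coordinate contributes the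
  nonnegative covariance \<open>p * (1 - p) * ((a0 - a1) * (b0 - b1))\<close>.\<close>

lemma harris:
  assumes "finite E" "0 \<le> p" "p \<le> 1"
    and "\<And>F G. F \<subseteq> G \<Longrightarrow> G \<subseteq> E \<Longrightarrow> f G \<le> f F"
    and "\<And>F G. F \<subseteq> G \<Longrightarrow> G \<subseteq> E \<Longrightarrow> g G \<le> g F"
  shows "bexp E p f * bexp E p g \<le> bexp E p (\<lambda>F. f F * g F)"
  using assms(1,4,5)
proof (induction E arbitrary: f g)
  case empty
  then show ?case by simp
next
  case (insert e E)
  let ?f1 = "\<lambda>F. f (insert e F)" and ?g1 = "\<lambda>F. g (insert e F)"
  define a1 a0 b1 b0 where
    "a1 = bexp E p ?f1" "a0 = bexp E p f" "b1 = bexp E p ?g1" "b0 = bexp E p g"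
  have ab: "a1 \<le> a0" "b1 \<le> b0"
    unfolding a1_a0_b1_b0_def using assms(2,3)
    by (auto intro!: bexp_mono insert.prems)
  have "a1 * b1 \<le> bexp E p (\<lambda>F. ?f1 F * ?g1 F)"
    unfolding a1_a0_b1_b0_def by (rule insert.IH) (auto intro!: insert.prems)
  moreover have "a0 * b0 \<le> bexp E p (\<lambda>F. f F * g F)"
    unfolding a1_a0_b1_b0_def by (rule insert.IH) (auto intro!: insert.prems)
  ultimately have "p * (a1 * b1) + (1 - p) * (a0 * b0) \<le> bexp (insert e E) p (\<lambda>F. f F * g F)"
    using insert.hyps assms(2,3) by (simp add: bexp_insert add_mono mult_left_mono)
  moreover have "0 \<le> p * (1 - p) * ((a0 - a1) * (b0 - b1))"
    using ab assms(2,3) by simp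
  moreover have "p * (a1 * b1) + (1 - p) * (a0 * b0)
      - (p * a1 + (1 - p) * a0) * (p * b1 + (1 - p) * b0)
      = p * (1 - p) * ((a0 - a1) * (b0 - b1))"
    by algebra
  moreover have "bexp (insert e E) p f * bexp (insert e E) p g
      = (p * a1 + (1 - p) * a0) * (p * b1 + (1 - p) * b0)"
    using insert.hyps by (simp add: bexp_insert a1_a0_b1_b0_def)
  ultimately show ?case by linarith
qed

text \<open>Nonnegativity makes a product of decreasing functions decreasing again, so the
  two-function case applies to one factor at a time.\<close>

lemma harris_prod:
  assumes "finite E" "0 \<le> p" "p \<le> 1" "finite I"
    and "\<And>i F G. i \<in> I \<Longrightarrow> F \<subseteq> G \<Longrightarrow> G \<subseteq> E \<Longrightarrow> f i G \<le> f i F"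
    and "\<And>i F. i \<in> I \<Longrightarrow> F \<subseteq> E \<Longrightarrow> 0 \<le> f i F"
  shows "(\<Prod>i\<in>I. bexp E p (f i)) \<le> bexp E p (\<lambda>F. \<Prod>i\<in>I. f i F)"
  using assms(4-6)
proof (induction I)
  case empty
  then show ?case using assms by (simp add: bexp_const)
next
  case (insert i I)
  have "bexp E p (f i) * (\<Prod>i\<in>I. bexp E p (f i))
      \<le> bexp E p (f i) * bexp E p (\<lambda>F. \<Prod>i\<in>I. f i F)"
    using insert.prems assms by (intro mult_left_mono insert.IH bexp_nonneg) auto
  also have "\<dots> \<le> bexp E p (\<lambda>F. f i F * (\<Prod>i\<in>I. f i F))"
    using insert.prems assms by (intro harris prod_mono conjI) auto
  finally show ?case using insert.hyps by simp
qed

text \<open>The set \<open>C F\<close> consists of the coordinates that an exploration of \<open>F\<close> inspects; the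
  hypothesis says that it is determined by what was inspected. Exchanging the remaining
  coordinates with those of an independent copy is a measure-preserving involution of
  the product space.\<close>

lemma bexp_resample:
  assumes "finite E"
    and stop: "\<And>F G. F \<subseteq> E \<Longrightarrow> G \<subseteq> E \<Longrightarrow> F \<inter> C F = G \<inter> C F \<Longrightarrow> C G = C F"
  shows "bexp E p h = bexp E p (\<lambda>F. bexp E p (\<lambda>G. h ((F \<inter> C F) \<union> (G - C F))))"
proof -
  define w where "w F = (\<Prod>e\<in>E. if e \<in> F then p else 1 - p)" for F
  \<comment> \<open>\<open>T\<close> exchanges the coordinates outside \<open>C F\<close>. By
    \<open>stop\<close> the first component of the image has the same inspected set, so a second
    application undoes the exchange.\<close>
  define T where "T = (\<lambda>(F, G). ((F \<inter> C F) \<union> (G - C F), (G \<inter> C F) \<union> (F - C F)))"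
  let ?X = "Pow E \<times> Pow E"
  have CT: "C (fst (T x)) = C (fst x)" if "x \<in> ?X" for x
  proof -
    obtain F G where x: "x = (F, G)" by (rule prod.exhaust)
    with \<open>x \<in> ?X\<close> have FG: "F \<subseteq> E" "G \<subseteq> E" by simp_all
    have "C ((F \<inter> C F) \<union> (G - C F)) = C F" using FG by (intro stop) auto
    then show ?thesis by (simp add: x T_def)
  qed
  have T_T: "T (T x) = x" "T x \<in> ?X" if "x \<in> ?X" for x
  proof -
    obtain F G where x: "x = (F, G)" by fastforce
    have "C ((F \<inter> C F) \<union> (G - C F)) = C F"
      using CT[OF that] by (simp add: x T_def)
    then show "T (T x) = x" by (simp add: x T_def) blast
    show "T x \<in> ?X" using that by (auto simp: x T_def)
  qed
  \<comment> \<open>At each coordinate the two memberships are kept or swapped, so the product of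
    their two factors does not change.\<close>
  have wT: "w (fst (T x)) * w (snd (T x)) = w (fst x) * w (snd x)" for x
    unfolding w_def prod.distrib[symmetric]
    by (intro prod.cong) (auto simp: T_def split: prod.splits)
  have "bexp E p h = bexp E p (\<lambda>F. bexp E p (\<lambda>_. h F))"
    using assms by (simp add: bexp_const)
  also have "\<dots> = (\<Sum>x\<in>?X. w (fst x) * w (snd x) * h (fst x))"
    by (simp add: bexp_def w_def sum.cartesian_product sum_distrib_left case_prod_unfold mult.assoc)
  also have "\<dots> = (\<Sum>x\<in>?X. w (fst (T x)) * w (snd (T x)) * h (fst (T x)))"
    by (rule sum.reindex_bij_witness[of _ T T]) (use T_T in auto)
  also have "\<dots> = (\<Sum>x\<in>?X. w (fst x) * w (snd x) * h (fst (T x)))"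
    by (simp add: wT)
  also have "\<dots> = bexp E p (\<lambda>F. bexp E p (\<lambda>G. h ((F \<inter> C F) \<union> (G - C F))))"
    by (simp add: bexp_def w_def sum.cartesian_product sum_distrib_left case_prod_unfold mult.assoc
        T_def)
  finally show ?thesis .
qed

section \<open>Neighbourhoods and survival\<close>

text \<open>Ball of radius \<open>j\<close> about \<open>\<sigma>\<close> in the graph on faces
  where two faces are adjacent if some simplex of \<open>F\<close> contains both.\<close>

fun nb :: "nat \<Rightarrow> nat set set \<Rightarrow> nat \<Rightarrow> nat set \<Rightarrow> nat set set" where
  "nb d F 0 \<sigma> = {\<sigma>}"
| "nb d F (Suc j) \<sigma> = nb d F j \<sigma> \<union>
    {\<rho>. card \<rho> = d \<and> (\<exists>\<tau>\<in>F. \<rho> \<subseteq> \<tau> \<and> (\<exists>\<rho>'\<in>nb d F j \<sigma>. \<rho>' \<subseteq> \<tau>))}"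

definition facets :: "nat \<Rightarrow> nat set \<Rightarrow> nat set set" where
  "facets d \<tau> = {\<sigma>. \<sigma> \<subseteq> \<tau> \<and> card \<sigma> = d}"

text \<open>When \<open>\<tau>\<close> is not in \<open>F\<close>, this is a path of at most
  \<open>j\<close> moves between two facets of \<open>\<tau>\<close>, which \<open>\<tau>\<close>
  itself would close to a cycle.\<close>

definition cyc :: "nat \<Rightarrow> nat \<Rightarrow> nat set set \<Rightarrow> nat set \<Rightarrow> bool" where
  "cyc d j F \<tau> \<longleftrightarrow> (\<exists>\<rho>\<in>facets d \<tau>. \<exists>\<rho>'\<in>facets d \<tau> - {\<rho>}. \<rho>' \<in> nb d F j \<rho>)"

text \<open>Removing \<open>\<tau>\<close> keeps its presence independent of the rest of the event; declaring \<open>\<sigma>\<close>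
  a survivor near a cycle makes the predicate an upper bound for survival under collapses.\<close>

fun surv :: "nat \<Rightarrow> nat \<Rightarrow> nat set set \<Rightarrow> nat set \<Rightarrow> bool" where
  "surv d 0 F \<sigma> = True"
| "surv d (Suc k) F \<sigma> = (\<exists>\<tau>\<in>F. \<sigma> \<subseteq> \<tau> \<and>
    (cyc d k (F - {\<tau>}) \<tau> \<or> (\<forall>\<sigma>'\<in>facets d \<tau> - {\<sigma>}. surv d k (F - {\<tau>}) \<sigma>')))"

section \<open>Paths between faces\<close>

lemma nb_self [simp]: "\<sigma> \<in> nb d F j \<sigma>"
  by (induction j) auto

lemma nb_Suc_mono: "nb d F j \<sigma> \<subseteq> nb d F (Suc j) \<sigma>"
  by auto

lemma nb_step_mono: "i \<le> j \<Longrightarrow> nb d F i \<sigma> \<subseteq> nb d F j \<sigma>"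
  by (rule lift_Suc_mono_le[of "\<lambda>i. nb d F i \<sigma>"]) auto

lemma nb_mono: "F \<subseteq> G \<Longrightarrow> nb d F j \<sigma> \<subseteq> nb d G j \<sigma>"
proof (induction j)
  case (Suc j)
  then show ?case by simp blast
qed simp

text \<open>A path is prefixed with a move through \<open>\<tau>\<close>. The recursion of
  \<open>nb\<close> appends moves at the far end, hence the induction.\<close>

lemma nb_via:
  assumes "\<tau> \<in> F" "\<sigma> \<subseteq> \<tau>" "\<sigma>' \<in> facets d \<tau>"
  shows "nb d F j \<sigma>' \<subseteq> nb d F (Suc j) \<sigma>"
proof (induction j)
  case 0
  then show ?case using assms by (auto simp: facets_def)
next
  case (Suc j)
  then show ?case by (simp only: nb.simps(2)[of d F j \<sigma>'] nb.simps(2)[of d F "Suc j" \<sigma>]) blast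
qed

text \<open>A path either avoids \<open>\<tau>\<close> or can be cut just before its first use of
  \<open>\<tau>\<close>, at a face of \<open>\<tau>\<close>.\<close>

lemma nb_Diff_cases:
  "\<rho> \<in> nb d F j \<sigma> \<Longrightarrow> \<rho> \<in> nb d (F - {\<tau>}) j \<sigma> \<or> (\<exists>\<rho>'\<in>nb d (F - {\<tau>}) j \<sigma>. \<rho>' \<subseteq> \<tau>)"
proof (induction j arbitrary: \<rho>)
  case (Suc j)
  show ?case
  proof (cases "\<rho> \<in> nb d F j \<sigma>")
    case True
    then show ?thesis using Suc.IH[of \<rho>] by auto
  next
    case False
    then obtain \<tau>' \<rho>' where h: "card \<rho> = d" "\<tau>' \<in> F" "\<rho> \<subseteq> \<tau>'" "\<rho>' \<in> nb d F j \<sigma>" "\<rho>' \<subseteq> \<tau>'"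
      using Suc.prems by auto
    show ?thesis
    proof (cases "\<exists>\<rho>''\<in>nb d (F - {\<tau>}) j \<sigma>. \<rho>'' \<subseteq> \<tau>")
      case True
      then show ?thesis using nb_Suc_mono by blast
    next
      case False
      then have "\<rho>' \<in> nb d (F - {\<tau>}) j \<sigma>" "\<tau>' \<in> F - {\<tau>}"
        using Suc.IH[OF h(4)] h by blast+
      then show ?thesis using h(1,3,5) by (simp only: nb.simps) blast
    qed
  qed
qed simp

text \<open>If the last simplex \<open>\<tau>\<close> of a path was used before, the path can be
  shortcut at its first entry into \<open>\<tau>\<close>. The part before the last move then avoids
  \<open>\<tau>\<close> and is independent of the presence of \<open>\<tau>\<close>.\<close>

lemma nb_last_step:
  assumes "\<rho> \<in> nb d F (Suc j) \<sigma>" "\<rho> \<noteq> \<sigma>"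
  shows "\<exists>\<tau>\<in>F. \<rho> \<in> facets d \<tau> \<and> (\<exists>\<rho>'\<in>nb d (F - {\<tau>}) j \<sigma>. \<rho>' \<subseteq> \<tau>)"
  using assms
proof (induction j arbitrary: \<rho>)
  case 0
  then show ?case unfolding nb.simps facets_def by blast
next
  case (Suc j)
  show ?case
  proof (cases "\<rho> \<in> nb d F (Suc j) \<sigma>")
    case True
    from Suc.IH[OF this Suc.prems(2)] show ?thesis using nb_Suc_mono by blast
  next
    case False
    then obtain \<tau> \<rho>' where h: "card \<rho> = d" "\<tau> \<in> F" "\<rho> \<subseteq> \<tau>" "\<rho>' \<in> nb d F (Suc j) \<sigma>" "\<rho>' \<subseteq> \<tau>"
      using Suc.prems(1) unfolding nb.simps(2)[of d F "Suc j" \<sigma>] by blast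
    moreover have "\<rho> \<in> facets d \<tau>" using h by (simp add: facets_def)
    ultimately show ?thesis using nb_Diff_cases[OF h(4), of \<tau>] by blast
  qed
qed

lemma nb_subset_faces:
  assumes "F \<subseteq> dsimplices n d" "\<sigma> \<in> facets d {1..n}"
  shows "nb d F j \<sigma> \<subseteq> facets d {1..n}"
proof (induction j)
  case (Suc j)
  have "\<rho> \<subseteq> {1..n}" if "\<tau> \<in> F" "\<rho> \<subseteq> \<tau>" for \<rho> \<tau>
    using that assms(1) unfolding dsimplices_def by blast
  then have "{\<rho>. card \<rho> = d \<and> (\<exists>\<tau>\<in>F. \<rho> \<subseteq> \<tau> \<and> (\<exists>\<rho>'\<in>nb d F j \<sigma>. \<rho>' \<subseteq> \<tau>))} \<subseteq> facets d {1..n}"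
    unfolding facets_def by auto
  then show ?case using Suc unfolding nb.simps by (rule Un_least[rotated])
qed (use assms in simp)

section \<open>Locality of neighbourhoods and survival\<close>

text \<open>The candidate simplices that an exploration queries when it leaves the ball of radius
  \<open>j\<close>. They are not restricted to \<open>F\<close>, since an absence is also revealed
  information.\<close>

definition touch :: "nat \<Rightarrow> nat set set \<Rightarrow> nat \<Rightarrow> nat set \<Rightarrow> nat set set" where
  "touch d F j \<sigma> = {\<tau>. \<exists>\<rho>\<in>nb d F j \<sigma>. \<rho> \<subseteq> \<tau>}"

text \<open>Growing a ball of radius \<open>j\<close> by one step queries only the simplices
  touching it, so the queries up to radius \<open>k\<close> determine the ball of radius
  \<open>Suc k\<close>.\<close>

lemma nb_local:
  assumes "F \<inter> touch d F k \<sigma> = G \<inter> touch d F k \<sigma>" "j \<le> Suc k"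
  shows "nb d G j \<sigma> = nb d F j \<sigma>"
  using assms(2)
proof (induction j)
  case (Suc j)
  then have IH: "nb d G j \<sigma> = nb d F j \<sigma>" by simp
  have "\<tau> \<in> F \<longleftrightarrow> \<tau> \<in> G" if "\<rho>' \<in> nb d F j \<sigma>" "\<rho>' \<subseteq> \<tau>" for \<tau> \<rho>'
  proof -
    have "\<tau> \<in> touch d F k \<sigma>"
      using that nb_step_mono[of j k d F \<sigma>] Suc.prems unfolding touch_def by blast
    then show ?thesis using assms(1) by blast
  qed
  then have "(\<exists>\<tau>\<in>G. \<rho> \<subseteq> \<tau> \<and> (\<exists>\<rho>'\<in>nb d F j \<sigma>. \<rho>' \<subseteq> \<tau>)) \<longleftrightarrow>
      (\<exists>\<tau>\<in>F. \<rho> \<subseteq> \<tau> \<and> (\<exists>\<rho>'\<in>nb d F j \<sigma>. \<rho>' \<subseteq> \<tau>))" for \<rho>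
    by metis
  then show ?case by (simp only: nb.simps IH)
qed simp

text \<open>This provides the hypothesis on inspected coordinates in
  \<open>bexp_resample\<close>.\<close>

lemma touch_local:
  assumes "F \<inter> touch d F k \<sigma> = G \<inter> touch d F k \<sigma>"
  shows "touch d G k \<sigma> = touch d F k \<sigma>"
  unfolding touch_def using nb_local[OF assms, of k] by simp

lemma cyc_mono: "F \<subseteq> G \<Longrightarrow> cyc d j F \<tau> \<Longrightarrow> cyc d j G \<tau>"
  unfolding cyc_def using nb_mono by blast

lemma surv_mono:
  assumes "F \<subseteq> G" "surv d k F \<sigma>"
  shows "surv d k G \<sigma>"
  using assms
proof (induction k arbitrary: F G \<sigma>)
  case (Suc k)
  from Suc.prems(2) obtain \<tau> where \<tau>: "\<tau> \<in> F" "\<sigma> \<subseteq> \<tau>"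
    "cyc d k (F - {\<tau>}) \<tau> \<or> (\<forall>\<sigma>'\<in>facets d \<tau> - {\<sigma>}. surv d k (F - {\<tau>}) \<sigma>')"
    unfolding surv.simps by (elim bexE conjE)
  have sub: "F - {\<tau>} \<subseteq> G - {\<tau>}" using Suc.prems(1) by (rule Diff_mono) simp
  have "cyc d k (G - {\<tau>}) \<tau> \<or> (\<forall>\<sigma>'\<in>facets d \<tau> - {\<sigma>}. surv d k (G - {\<tau>}) \<sigma>')"
    using \<tau>(3) cyc_mono[OF sub] Suc.IH[OF sub] by meson
  then show ?case unfolding surv.simps using subsetD[OF Suc.prems(1) \<tau>(1)] \<tau>(2) by (intro bexI conjI)
qed simp

text \<open>After a move through \<open>\<tau>\<close>, the ball of radius \<open>k\<close> about a
  facet of \<open>\<tau>\<close> lies in the ball of radius \<open>Suc k\<close> about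
  \<open>\<sigma>\<close>, so the agreement passes to both alternatives of the recursion. The
  converse follows because \<open>touch_local\<close> makes the hypothesis symmetric.\<close>

lemma surv_local_imp:
  assumes "F \<inter> touch d F k \<sigma> = G \<inter> touch d F k \<sigma>" "surv d k F \<sigma>"
  shows "surv d k G \<sigma>"
  using assms
proof (induction k arbitrary: F G \<sigma>)
  case (Suc k)
  from Suc.prems(2) obtain \<tau> where \<tau>: "\<tau> \<in> F" "\<sigma> \<subseteq> \<tau>"
    "cyc d k (F - {\<tau>}) \<tau> \<or> (\<forall>\<sigma>'\<in>facets d \<tau> - {\<sigma>}. surv d k (F - {\<tau>}) \<sigma>')"
    unfolding surv.simps by (elim bexE conjE)
  have "\<tau> \<in> touch d F (Suc k) \<sigma>"
    using \<tau>(2) nb_self[of \<sigma> d F "Suc k"] unfolding touch_def by blast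
  then have tG: "\<tau> \<in> G" using \<tau>(1) Suc.prems(1) by (metis Int_iff)
  have agree: "(F - {\<tau>}) \<inter> touch d (F - {\<tau>}) k \<sigma>' = (G - {\<tau>}) \<inter> touch d (F - {\<tau>}) k \<sigma>'"
    if "\<sigma>' \<in> facets d \<tau>" for \<sigma>'
  proof -
    have "nb d (F - {\<tau>}) k \<sigma>' \<subseteq> nb d F (Suc k) \<sigma>"
      using nb_mono[of "F - {\<tau>}" F d k \<sigma>'] nb_via[OF \<tau>(1,2) that, of k] by (meson Diff_subset order_trans)
    then have "touch d (F - {\<tau>}) k \<sigma>' \<subseteq> touch d F (Suc k) \<sigma>" unfolding touch_def by blast
    then have "(X - {\<tau>}) \<inter> touch d (F - {\<tau>}) k \<sigma>'
        = (X \<inter> touch d F (Suc k) \<sigma>) \<inter> (touch d (F - {\<tau>}) k \<sigma>' - {\<tau>})" for X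
      by blast
    then show ?thesis by (simp only: Suc.prems(1))
  qed
  have "cyc d k (G - {\<tau>}) \<tau> = cyc d k (F - {\<tau>}) \<tau>"
    using nb_local[OF agree, of _ k] unfolding cyc_def by (intro bex_cong) simp_all
  moreover have "surv d k (G - {\<tau>}) \<sigma>'" if "\<sigma>' \<in> facets d \<tau>" "surv d k (F - {\<tau>}) \<sigma>'" for \<sigma>'
    using Suc.IH[OF agree[OF that(1)] that(2)] .
  ultimately have "cyc d k (G - {\<tau>}) \<tau> \<or> (\<forall>\<sigma>'\<in>facets d \<tau> - {\<sigma>}. surv d k (G - {\<tau>}) \<sigma>')"
    using \<tau>(3) by (metis DiffD1)
  then show ?case unfolding surv.simps using tG \<tau>(2) by (intro bexI conjI)
qed simp

lemma surv_local:
  assumes "F \<inter> touch d F k \<sigma> = G \<inter> touch d F k \<sigma>"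
  shows "surv d k G \<sigma> = surv d k F \<sigma>"
proof -
  have "G \<inter> touch d G k \<sigma> = F \<inter> touch d G k \<sigma>"
    unfolding touch_local[OF assms] by (rule assms[symmetric])
  from surv_local_imp[OF this] surv_local_imp[OF assms] show ?thesis by (rule iffI)
qed

section \<open>From collapses to survival\<close>

text \<open>If \<open>\<tau>\<close> were the only simplex containing \<open>\<sigma>\<close>, then
  \<open>\<sigma>\<close> would be free and \<open>\<tau>\<close> would be removed.\<close>

lemma collapse_step_survivor:
  assumes "\<tau> \<in> collapse_step d F" "\<sigma> \<in> facets d \<tau>"
  shows "\<exists>\<tau>'\<in>F. \<sigma> \<subseteq> \<tau>' \<and> \<tau>' \<noteq> \<tau>"
proof -
  have \<sigma>: "\<sigma> \<subseteq> \<tau>" "card \<sigma> = d" using assms(2) by (simp_all add: facets_def)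
  have \<tau>: "\<tau> \<in> F" "\<not> (\<exists>\<sigma>. \<sigma> \<subseteq> \<tau> \<and> card \<sigma> = d \<and> free_face F \<sigma>)"
    using assms(1) by (simp_all add: collapse_step_def)
  have "{\<tau>'\<in>F. \<sigma> \<subseteq> \<tau>'} \<noteq> {\<tau>}"
  proof
    assume "{\<tau>'\<in>F. \<sigma> \<subseteq> \<tau>'} = {\<tau>}"
    then have "free_face F \<sigma>" by (simp add: free_face_def)
    then show False using \<tau>(2) \<sigma> by metis
  qed
  then show ?thesis using \<tau>(1) \<sigma>(1) by blast
qed

lemma collapse_subset: "(collapse_step d ^^ k) F \<subseteq> F"
  by (induction k) (auto simp: collapse_step_def)

text \<open>Induction invariant: from \<open>\<sigma>\<close> the remaining complex \<open>G\<close> does not lead back to the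
  simplices removed so far, except to the last one at \<open>\<sigma>\<close> itself.\<close>

lemma surv_if_not_collapsed_gen:
  assumes "G \<subseteq> F" "\<tau> \<in> F"
    and "\<And>\<rho> \<tau>'. \<rho> \<in> nb d G k \<sigma> \<Longrightarrow> \<tau>' \<in> F - G \<Longrightarrow> \<rho> \<subseteq> \<tau>' \<Longrightarrow> \<rho> = \<sigma> \<and> \<tau>' = \<tau>"
    and "\<tau> \<in> (collapse_step d ^^ k) F" "\<sigma> \<in> facets d \<tau>"
  shows "surv d k G \<sigma>"
  using assms
proof (induction k arbitrary: G \<sigma> \<tau>)
  case (Suc k)
  note inv = Suc.prems(3)
  let ?R = "(collapse_step d ^^ k) F"
  \<comment> \<open>Since \<open>\<tau>\<close> survives one more round, \<open>\<sigma>\<close> is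
    not free after \<open>k\<close> rounds and has another coface left.\<close>
  obtain \<tau>' where \<tau>': "\<tau>' \<in> ?R" "\<sigma> \<subseteq> \<tau>'" "\<tau>' \<noteq> \<tau>"
    using collapse_step_survivor[of \<tau> d ?R \<sigma>] Suc.prems(4,5) by auto
  have F: "\<tau>' \<in> F" using \<tau>'(1) collapse_subset by blast
  \<comment> \<open>Otherwise the invariant, applied at \<open>\<sigma>\<close> itself, would give
    \<open>\<tau>' = \<tau>\<close>.\<close>
  have G: "\<tau>' \<in> G" using inv[of \<sigma> \<tau>'] \<tau>' F by auto
  have fs: "\<sigma> \<in> facets d \<tau>'" using \<tau>' Suc.prems(5) by (auto simp: facets_def)
  have "surv d k (G - {\<tau>'}) \<sigma>'" if nc: "\<not> cyc d k (G - {\<tau>'}) \<tau>'"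
    and \<sigma>': "\<sigma>' \<in> facets d \<tau>' - {\<sigma>}" for \<sigma>'
  proof (rule Suc.IH[of _ \<tau>'])
    fix \<rho> \<tau>'' assume h: "\<rho> \<in> nb d (G - {\<tau>'}) k \<sigma>'" "\<tau>'' \<in> F - (G - {\<tau>'})" "\<rho> \<subseteq> \<tau>''"
    have card: "card \<rho> = d"
    proof -
      have "nb d (G - {\<tau>'}) k \<sigma>' \<subseteq> {\<rho>. card \<rho> = d}"
        using \<sigma>' by (induction k) (auto simp: facets_def)
      then show ?thesis using h(1) by blast
    qed
    show "\<rho> = \<sigma>' \<and> \<tau>'' = \<tau>'"
    proof (cases "\<tau>'' = \<tau>'")
      \<comment> \<open>Without a cycle at \<open>\<tau>'\<close>, the only facet of
        \<open>\<tau>'\<close> reached from \<open>\<sigma>'\<close> is \<open>\<sigma>'\<close>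
        itself.\<close>
      case True
      then have "\<rho> \<in> facets d \<tau>'" using h(3) card by (simp add: facets_def)
      then show ?thesis using nc \<sigma>' h(1) True unfolding cyc_def by blast
    next
      \<comment> \<open>By the old invariant a simplex removed earlier can be met only at
        \<open>\<sigma>\<close>, but reaching \<open>\<sigma>\<close> from \<open>\<sigma>'\<close>
        without \<open>\<tau>'\<close> would be a cycle.\<close>
      case False
      have "\<rho> \<in> nb d G (Suc k) \<sigma>"
        using h(1) \<sigma>' nb_mono[of "G - {\<tau>'}" G d k \<sigma>'] nb_via[OF G \<tau>'(2), of \<sigma>' d k] by blast
      then have "\<rho> = \<sigma>" using inv[of \<rho> \<tau>''] h False by auto
      then show ?thesis using nc \<sigma>' h(1) fs unfolding cyc_def by blast
    qed
  qed (use Suc.prems(1) \<sigma>' F \<tau>'(1) in auto)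
  then show ?case unfolding surv.simps using G \<tau>'(2) by blast
qed simp

text \<open>The invariant holds when only \<open>\<tau>\<close> has been removed: without a cycle,
  no other facet of \<open>\<tau>\<close> is reached from \<open>\<sigma>\<close>.\<close>

lemma surv_if_not_collapsed:
  assumes "\<tau> \<in> (collapse_step d ^^ k) F" "\<sigma> \<in> facets d \<tau>" "\<not> cyc d k (F - {\<tau>}) \<tau>"
  shows "surv d k (F - {\<tau>}) \<sigma>"
proof (rule surv_if_not_collapsed_gen)
  show "\<tau> \<in> F" using assms(1) collapse_subset by blast
  fix \<rho> \<tau>' assume h: "\<rho> \<in> nb d (F - {\<tau>}) k \<sigma>" "\<tau>' \<in> F - (F - {\<tau>})" "\<rho> \<subseteq> \<tau>'"
  have "nb d (F - {\<tau>}) k \<sigma> \<subseteq> {\<rho>. card \<rho> = d}"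
    using assms(2) by (induction k) (auto simp: facets_def)
  then have "\<rho> \<in> facets d \<tau>" using h by (auto simp: facets_def)
  then show "\<rho> = \<sigma> \<and> \<tau>' = \<tau>" using h assms(2,3) unfolding cyc_def by blast
qed (use assms in auto)

section \<open>Neighbourhood and survival probabilities\<close>

lemma finite_dsimplices: "finite (dsimplices n d)"
  by (rule finite_subset[of _ "Pow {1..n}"]) (auto simp: dsimplices_def)

lemma finite_facets: "finite \<tau> \<Longrightarrow> finite (facets d \<tau>)"
  by (rule finite_subset[of _ "Pow \<tau>"]) (auto simp: facets_def)

lemma card_facets: "\<tau> \<in> dsimplices n d \<Longrightarrow> card (facets d \<tau>) = Suc d"
  using n_subsets[of \<tau> d] finite_subset[of \<tau> "{1..n}"]
  by (simp add: facets_def dsimplices_def)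

lemma facets_dsimplex:
  "\<tau> \<in> dsimplices n d \<Longrightarrow> facets d \<tau> = {\<rho> \<in> facets d {1..n}. \<rho> \<subseteq> \<tau>}"
  by (auto simp: facets_def dsimplices_def)

text \<open>A coface arises from \<open>\<rho>\<close> by adding one of the \<open>n\<close>
  vertices.\<close>

lemma card_cofaces:
  assumes "\<rho> \<in> facets d {1..n}"
  shows "card {\<tau>\<in>dsimplices n d. \<rho> \<subseteq> \<tau>} \<le> n"
proof -
  have "{\<tau>\<in>dsimplices n d. \<rho> \<subseteq> \<tau>} \<subseteq> (\<lambda>v. insert v \<rho>) ` {1..n}"
  proof
    fix \<tau> assume \<tau>: "\<tau> \<in> {\<tau>\<in>dsimplices n d. \<rho> \<subseteq> \<tau>}"
    then have fin: "finite \<tau>" by (auto simp: dsimplices_def intro: finite_subset)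
    have "card (\<tau> - \<rho>) = 1"
      using \<tau> assms fin by (subst card_Diff_subset)
        (auto simp: dsimplices_def facets_def intro: finite_subset)
    then obtain v where "\<tau> - \<rho> = {v}" by (rule card_1_singletonE)
    then have "\<tau> = insert v \<rho>" "v \<in> \<tau>" using \<tau> by auto
    then show "\<tau> \<in> (\<lambda>v. insert v \<rho>) ` {1..n}"
      using \<tau> by (auto simp: dsimplices_def)
  qed
  then have "card {\<tau>\<in>dsimplices n d. \<rho> \<subseteq> \<tau>} \<le> card ((\<lambda>v. insert v \<rho>) ` {1..n})"
    by (intro card_mono) auto
  also have "\<dots> \<le> n" using card_image_le[of "{1..n}"] by simp
  finally show ?thesis .
qed

text \<open>The assumption \<open>c < n\<close> makes \<open>c / n\<close> a probability strictly
  below 1, which holds for all large \<open>n\<close>.\<close>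

locale linial_meshulam =
  fixes n d :: nat and c :: real
  assumes c_pos: "0 < c" and c_less_n: "c < n"
begin

definition p :: real where "p = c / n"

text \<open>Growth factor of an exploration per round: a face has at most \<open>n\<close> cofaces,
  each present with probability \<open>c / n\<close> and carrying \<open>d + 1\<close> facets. The
  extra \<open>1\<close> and \<open>c\<close> absorb the contribution of the starting face in the
  two inductions below.\<close>

definition K :: real where "K = 1 + c * (d + 2)"

abbreviation "E \<equiv> dsimplices n d"

abbreviation "faces \<equiv> facets d {1..n}"

definition Pr :: "(nat set set \<Rightarrow> bool) \<Rightarrow> real" where
  "Pr P = bexp E p (\<lambda>F. of_bool (P F))"

definition reach :: "nat \<Rightarrow> nat set \<Rightarrow> nat set \<Rightarrow> real" where
  "reach j \<sigma> \<rho> = Pr (\<lambda>F. \<rho> \<in> nb d F j \<sigma>)"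

lemma n_pos: "0 < n"
  using c_pos c_less_n by (cases n) auto

lemma p_bounds: "0 < p" "p < 1" "0 \<le> p" "p \<le> 1"
  using c_pos c_less_n n_pos by (auto simp: p_def)

lemma n_p: "real n * p = c"
  using n_pos by (simp add: p_def)

lemma K_ge_1: "1 \<le> K" "1 \<le> K ^ j"
  using c_pos by (auto simp: K_def one_le_power)

lemma finite_faces: "finite faces"
  by (simp add: finite_facets)

lemma Pr_mono: "(\<And>F. F \<subseteq> E \<Longrightarrow> P F \<Longrightarrow> Q F) \<Longrightarrow> Pr P \<le> Pr Q"
  unfolding Pr_def by (rule bexp_mono) (auto simp: p_bounds)

lemma Pr_nonneg: "0 \<le> Pr P"
  unfolding Pr_def by (rule bexp_nonneg) (auto simp: p_bounds)

lemma Pr_le_1: "Pr P \<le> 1"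
  unfolding Pr_def by (rule bexp_le_1) (auto simp: p_bounds finite_dsimplices)

lemma Pr_bex_le:
  assumes "finite I"
  shows "Pr (\<lambda>F. \<exists>i\<in>I. P i F) \<le> (\<Sum>i\<in>I. Pr (P i))"
  unfolding Pr_def bexp_sum[symmetric]
proof (rule bexp_mono)
  fix F
  show "of_bool (\<exists>i\<in>I. P i F) \<le> (\<Sum>i\<in>I. of_bool (P i F) :: real)"
  proof (cases "\<exists>i\<in>I. P i F")
    case True
    then obtain i where "i \<in> I" "P i F" by blast
    then show ?thesis
      using member_le_sum[of i I "\<lambda>i. of_bool (P i F) :: real"] assms by auto
  qed (simp add: sum_nonneg)
qed (auto simp: p_bounds)

lemma Pr_disj_le: "Pr (\<lambda>F. P F \<or> Q F) \<le> Pr P + Pr Q"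
  unfolding Pr_def bexp_add[symmetric] by (rule bexp_mono) (auto simp: p_bounds)

text \<open>The presence of \<open>\<tau>\<close> is independent of \<open>F - {\<tau>}\<close>;
  monotonicity then allows \<open>\<tau>\<close> to be put back.\<close>

lemma Pr_present_le:
  assumes "\<tau> \<in> E" "\<And>F G. F \<subseteq> G \<Longrightarrow> P F \<Longrightarrow> P G"
  shows "Pr (\<lambda>F. \<tau> \<in> F \<and> P (F - {\<tau>})) \<le> p * Pr P"
proof -
  have "Pr (\<lambda>F. \<tau> \<in> F \<and> P (F - {\<tau>})) = p * Pr (\<lambda>F. P (F - {\<tau>}))"
    using bexp_indep[OF finite_dsimplices assms(1), of p "\<lambda>F. of_bool (P F)"]
    by (simp add: Pr_def of_bool_conj)
  also have "\<dots> \<le> p * Pr P"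
    using p_bounds by (intro mult_left_mono Pr_mono) (auto intro: assms(2)[of "_ - {\<tau>}"])
  finally show ?thesis .
qed

lemma sum_cofaces_le:
  fixes f :: "nat set \<Rightarrow> real" and k :: real
  assumes "\<rho> \<in> faces" "\<And>\<tau>. \<tau> \<in> E \<Longrightarrow> \<rho> \<subseteq> \<tau> \<Longrightarrow> f \<tau> \<le> k" "0 \<le> k"
  shows "(\<Sum>\<tau>\<in>{\<tau>\<in>E. \<rho> \<subseteq> \<tau>}. f \<tau>) \<le> n * k"
proof -
  have "(\<Sum>\<tau>\<in>{\<tau>\<in>E. \<rho> \<subseteq> \<tau>}. f \<tau>) \<le> card {\<tau>\<in>E. \<rho> \<subseteq> \<tau>} * k"
    by (rule sum_bounded_above) (use assms(2) in auto)
  also have "\<dots> \<le> n * k"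
    using card_cofaces[OF assms(1)] assms(3) by (intro mult_right_mono) auto
  finally show ?thesis .
qed

section \<open>First-moment bounds for neighbourhoods and cycles\<close>

lemma reach_nonneg: "0 \<le> reach j \<sigma> \<rho>"
  by (simp add: reach_def Pr_nonneg)

text \<open>Union bound over the last simplex \<open>\<tau>\<close> of a path and the face at which
  \<open>\<tau>\<close> is entered. By \<open>nb_last_step\<close> the rest of the path avoids
  \<open>\<tau>\<close>, whose presence therefore costs a factor \<open>p\<close>.\<close>

lemma reach_Suc_le:
  assumes "\<sigma> \<in> faces" "\<rho> \<noteq> \<sigma>"
  shows "reach (Suc j) \<sigma> \<rho> \<le> (\<Sum>\<tau>\<in>{\<tau>\<in>E. \<rho> \<subseteq> \<tau>}. p * (\<Sum>\<rho>'\<in>facets d \<tau>. reach j \<sigma> \<rho>'))"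
proof -
  have "reach (Suc j) \<sigma> \<rho> \<le> Pr (\<lambda>F. \<exists>\<tau>\<in>{\<tau>\<in>E. \<rho> \<subseteq> \<tau>}. \<tau> \<in> F \<and>
      (\<exists>\<rho>'\<in>facets d \<tau>. \<rho>' \<in> nb d (F - {\<tau>}) j \<sigma>))"
    unfolding reach_def
  proof (rule Pr_mono)
    fix F assume F: "F \<subseteq> E" "\<rho> \<in> nb d F (Suc j) \<sigma>"
    from nb_last_step[OF F(2) assms(2)] obtain \<tau> \<rho>' where
      \<tau>: "\<tau> \<in> F" "\<rho> \<in> facets d \<tau>" "\<rho>' \<in> nb d (F - {\<tau>}) j \<sigma>" "\<rho>' \<subseteq> \<tau>" by blast
    have "\<rho>' \<in> faces" using nb_subset_faces[of "F - {\<tau>}" n d \<sigma> j] F(1) assms(1) \<tau>(3) by blast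
    then have "\<rho>' \<in> facets d \<tau>" using \<tau>(4) by (simp add: facets_def)
    moreover have "\<rho> \<subseteq> \<tau>" "\<tau> \<in> E" using \<tau> F by (auto simp: facets_def)
    ultimately show "\<exists>\<tau>\<in>{\<tau>\<in>E. \<rho> \<subseteq> \<tau>}. \<tau> \<in> F \<and>
      (\<exists>\<rho>'\<in>facets d \<tau>. \<rho>' \<in> nb d (F - {\<tau>}) j \<sigma>)" using \<tau> by blast
  qed
  also have "\<dots> \<le> (\<Sum>\<tau>\<in>{\<tau>\<in>E. \<rho> \<subseteq> \<tau>}. Pr (\<lambda>F. \<tau> \<in> F \<and>
      (\<exists>\<rho>'\<in>facets d \<tau>. \<rho>' \<in> nb d (F - {\<tau>}) j \<sigma>)))"
    by (rule Pr_bex_le) (simp add: finite_dsimplices)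
  also have "\<dots> \<le> (\<Sum>\<tau>\<in>{\<tau>\<in>E. \<rho> \<subseteq> \<tau>}. p * (\<Sum>\<rho>'\<in>facets d \<tau>. reach j \<sigma> \<rho>'))"
  proof (rule sum_mono)
    fix \<tau> assume \<tau>: "\<tau> \<in> {\<tau>\<in>E. \<rho> \<subseteq> \<tau>}"
    have "Pr (\<lambda>F. \<tau> \<in> F \<and> (\<exists>\<rho>'\<in>facets d \<tau>. \<rho>' \<in> nb d (F - {\<tau>}) j \<sigma>))
        \<le> p * Pr (\<lambda>F. \<exists>\<rho>'\<in>facets d \<tau>. \<rho>' \<in> nb d F j \<sigma>)"
      using \<tau> nb_mono by (intro Pr_present_le[where P = "\<lambda>F. \<exists>\<rho>'\<in>facets d \<tau>. \<rho>' \<in> nb d F j \<sigma>"]) blast+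
    also have "\<dots> \<le> p * (\<Sum>\<rho>'\<in>facets d \<tau>. reach j \<sigma> \<rho>')"
      unfolding reach_def using \<tau> p_bounds facets_dsimplex[of \<tau> n d]
      by (intro mult_left_mono Pr_bex_le) (auto intro: finite_subset[OF _ finite_faces])
    finally show "Pr (\<lambda>F. \<tau> \<in> F \<and> (\<exists>\<rho>'\<in>facets d \<tau>. \<rho>' \<in> nb d (F - {\<tau>}) j \<sigma>))
        \<le> p * (\<Sum>\<rho>'\<in>facets d \<tau>. reach j \<sigma> \<rho>')" .
  qed
  finally show ?thesis .
qed

text \<open>The starting face is reached with probability one, but only the coface
  \<open>\<rho> \<union> \<sigma>\<close> contains it, which adds a single \<open>p\<close>. All
  other entries are of order \<open>1 / n\<close> by induction, and summing over at most
  \<open>n\<close> cofaces costs \<open>n * p = c\<close>.\<close>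

lemma reach_le:
  assumes "\<sigma> \<in> faces" "\<rho> \<in> faces" "\<rho> \<noteq> \<sigma>"
  shows "reach j \<sigma> \<rho> \<le> K ^ j / n"
  using assms(2,3)
proof (induction j arbitrary: \<rho>)
  case 0
  then show ?case by (simp add: reach_def Pr_def bexp_const finite_dsimplices)
next
  case (Suc j)
  let ?S = "{\<tau>\<in>E. \<rho> \<subseteq> \<tau>}"
  have finS: "finite ?S" by (simp add: finite_dsimplices)
  have inner: "(\<Sum>\<rho>'\<in>facets d \<tau>. reach j \<sigma> \<rho>')
      \<le> of_bool (\<tau> = \<rho> \<union> \<sigma>) + (d + 1) * (K ^ j / n)" if \<tau>: "\<tau> \<in> ?S" for \<tau>
  proof -
    have fin: "finite (facets d \<tau>)"
      using \<tau> facets_dsimplex[of \<tau> n d] by (auto intro: finite_subset[OF _ finite_faces])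
    \<comment> \<open>Two distinct \<open>d\<close>-sets have a union of at least
      \<open>d + 1\<close> elements, which exhausts \<open>\<tau>\<close>.\<close>
    have un: "\<tau> = \<rho> \<union> \<sigma>" if \<sigma>: "\<sigma> \<in> facets d \<tau>"
    proof (rule card_seteq[symmetric])
      show "finite \<tau>" using \<tau> by (auto simp: dsimplices_def intro: finite_subset)
      show "\<rho> \<union> \<sigma> \<subseteq> \<tau>" using \<tau> \<sigma> by (auto simp: facets_def)
      have f: "finite \<rho>" "finite \<sigma>" "card \<rho> = d" "card \<sigma> = d"
        using Suc.prems assms(1) by (auto simp: facets_def intro: finite_subset)
      have "\<rho> \<subset> \<rho> \<union> \<sigma>"
        using f Suc.prems card_seteq[of \<rho> \<sigma>] by auto
      then have "d < card (\<rho> \<union> \<sigma>)" using psubset_card_mono[of "\<rho> \<union> \<sigma>" \<rho>] f by auto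
      then show "card \<tau> \<le> card (\<rho> \<union> \<sigma>)" using \<tau> by (simp add: dsimplices_def)
    qed
    have "(\<Sum>\<rho>'\<in>facets d \<tau>. reach j \<sigma> \<rho>')
        \<le> (\<Sum>\<rho>'\<in>facets d \<tau>. of_bool (\<rho>' = \<sigma>) + K ^ j / n)"
    proof (rule sum_mono)
      fix \<rho>' assume "\<rho>' \<in> facets d \<tau>"
      then have "\<rho>' \<in> faces" using \<tau> facets_dsimplex[of \<tau> n d] by auto
      then show "reach j \<sigma> \<rho>' \<le> of_bool (\<rho>' = \<sigma>) + K ^ j / n"
        using Suc.IH[of \<rho>'] Pr_le_1[of "\<lambda>F. \<rho>' \<in> nb d F j \<sigma>"] K_ge_1(2)[of j]
        by (cases "\<rho>' = \<sigma>") (auto simp: reach_def intro: add_increasing2)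
    qed
    also have "\<dots> = (\<Sum>\<rho>'\<in>facets d \<tau>. of_bool (\<rho>' = \<sigma>)) + (d + 1) * (K ^ j / n)"
      using \<tau> card_facets[of \<tau> n d] by (simp add: sum.distrib)
    also have "(\<Sum>\<rho>'\<in>facets d \<tau>. of_bool (\<rho>' = \<sigma>) :: real) = of_bool (\<sigma> \<in> facets d \<tau>)"
      using fin by (simp add: of_bool_def)
    also have "\<dots> \<le> (of_bool (\<tau> = \<rho> \<union> \<sigma>) :: real)" using un by simp
    finally show ?thesis by simp
  qed
  have "reach (Suc j) \<sigma> \<rho> \<le> (\<Sum>\<tau>\<in>?S. p * (\<Sum>\<rho>'\<in>facets d \<tau>. reach j \<sigma> \<rho>'))"
    using reach_Suc_le assms(1) Suc.prems by simp
  also have "\<dots> \<le> (\<Sum>\<tau>\<in>?S. p * (of_bool (\<tau> = \<rho> \<union> \<sigma>) + (d + 1) * (K ^ j / n)))"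
    using p_bounds inner by (intro sum_mono mult_left_mono) auto
  also have "\<dots> = p * (\<Sum>\<tau>\<in>?S. of_bool (\<tau> = \<rho> \<union> \<sigma>)) + (\<Sum>\<tau>\<in>?S. p * ((d + 1) * (K ^ j / n)))"
    by (simp only: distrib_left sum.distrib sum_distrib_left)
  also have "\<dots> \<le> p * 1 + n * (p * ((d + 1) * (K ^ j / n)))"
  proof (rule add_mono)
    have "(\<Sum>\<tau>\<in>?S. of_bool (\<tau> = \<rho> \<union> \<sigma>) :: real) = of_bool (\<rho> \<union> \<sigma> \<in> ?S)"
      using finS by (simp add: of_bool_def)
    also have "\<dots> \<le> 1" by simp
    finally show "p * (\<Sum>\<tau>\<in>?S. of_bool (\<tau> = \<rho> \<union> \<sigma>)) \<le> p * 1"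
      using p_bounds by (intro mult_left_mono) auto
    show "(\<Sum>\<tau>\<in>?S. p * ((d + 1) * (K ^ j / n))) \<le> n * (p * ((d + 1) * (K ^ j / n)))"
      using p_bounds K_ge_1(2)[of j] by (intro sum_cofaces_le Suc.prems) auto
  qed
  also have "\<dots> = (c + c * (d + 1) * K ^ j) / n"
    using n_pos by (simp add: p_def field_simps)
  also have "\<dots> \<le> K ^ Suc j / n"
  proof (rule divide_right_mono)
    have "c * 1 \<le> c * K ^ j" using K_ge_1(2)[of j] c_pos by (intro mult_left_mono) auto
    then have "c + c * (d + 1) * K ^ j \<le> c * (d + 2) * K ^ j" by (simp add: algebra_simps)
    also have "\<dots> \<le> K * K ^ j" using K_ge_1(2)[of j] by (intro mult_right_mono) (auto simp: K_def)
    finally show "c + c * (d + 1) * K ^ j \<le> K ^ Suc j" by simp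
  qed simp
  finally show ?case .
qed

text \<open>Expected size of a ball. Double counting of incidences turns the recursion into a factor
  \<open>d + 1\<close> for the facets of each simplex and \<open>n * p = c\<close> for the cofaces
  of each face.\<close>

lemma sum_reach_le:
  assumes "\<sigma> \<in> faces"
  shows "(\<Sum>\<rho>\<in>faces. reach j \<sigma> \<rho>) \<le> K ^ j"
proof (induction j)
  case 0
  have "reach 0 \<sigma> \<rho> = (if \<rho> = \<sigma> then 1 else 0)" for \<rho>
    by (simp add: reach_def Pr_def bexp_const finite_dsimplices)
  then show ?case using finite_faces assms by simp
next
  case (Suc j)
  let ?r = "reach j \<sigma>"
  have "(\<Sum>\<rho>\<in>faces. reach (Suc j) \<sigma> \<rho>)
      = reach (Suc j) \<sigma> \<sigma> + (\<Sum>\<rho>\<in>faces - {\<sigma>}. reach (Suc j) \<sigma> \<rho>)"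
    using assms finite_faces by (simp add: sum.remove)
  also have "\<dots> \<le> 1 + (\<Sum>\<rho>\<in>faces - {\<sigma>}. \<Sum>\<tau>\<in>{\<tau>\<in>E. \<rho> \<subseteq> \<tau>}. p * (\<Sum>\<rho>'\<in>facets d \<tau>. ?r \<rho>'))"
    using assms by (intro add_mono sum_mono reach_Suc_le) (auto simp: reach_def Pr_le_1)
  also have "\<dots> \<le> 1 + (\<Sum>\<rho>\<in>faces. \<Sum>\<tau>\<in>{\<tau>\<in>E. \<rho> \<subseteq> \<tau>}. p * (\<Sum>\<rho>'\<in>facets d \<tau>. ?r \<rho>'))"
    using p_bounds finite_faces
    by (intro add_left_mono sum_mono2 sum_nonneg mult_nonneg_nonneg reach_nonneg) auto
  also have "(\<Sum>\<rho>\<in>faces. \<Sum>\<tau>\<in>{\<tau>\<in>E. \<rho> \<subseteq> \<tau>}. p * (\<Sum>\<rho>'\<in>facets d \<tau>. ?r \<rho>'))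
      = (\<Sum>\<tau>\<in>E. \<Sum>\<rho>\<in>{\<rho>\<in>faces. \<rho> \<subseteq> \<tau>}. p * (\<Sum>\<rho>'\<in>facets d \<tau>. ?r \<rho>'))"
    by (rule sum.swap_restrict) (rule finite_faces finite_dsimplices)+
  also have "\<dots> = (\<Sum>\<tau>\<in>E. \<Sum>\<rho>'\<in>{\<rho>\<in>faces. \<rho> \<subseteq> \<tau>}. p * (d + 1) * ?r \<rho>')"
  proof (rule sum.cong)
    fix \<tau> assume "\<tau> \<in> E"
    then show "(\<Sum>\<rho>\<in>{\<rho>\<in>faces. \<rho> \<subseteq> \<tau>}. p * (\<Sum>\<rho>'\<in>facets d \<tau>. ?r \<rho>'))
        = (\<Sum>\<rho>'\<in>{\<rho>\<in>faces. \<rho> \<subseteq> \<tau>}. p * (d + 1) * ?r \<rho>')"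
      unfolding facets_dsimplex[OF \<open>\<tau> \<in> E\<close>, symmetric] sum_constant sum_distrib_left[symmetric]
      using card_facets[of \<tau> n d] by simp
  qed simp
  also have "\<dots> = (\<Sum>\<rho>'\<in>faces. \<Sum>\<tau>\<in>{\<tau>\<in>E. \<rho>' \<subseteq> \<tau>}. p * (d + 1) * ?r \<rho>')"
    by (rule sum.swap_restrict[symmetric]) (rule finite_faces finite_dsimplices)+
  also have "\<dots> \<le> (\<Sum>\<rho>'\<in>faces. n * (p * (d + 1) * ?r \<rho>'))"
    using p_bounds by (intro sum_mono sum_cofaces_le) (auto simp: reach_nonneg)
  also have "\<dots> = c * (d + 1) * (\<Sum>\<rho>'\<in>faces. ?r \<rho>')"
    using n_p by (simp add: sum_distrib_left mult.assoc[symmetric])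
  also have "1 + \<dots> \<le> K ^ j + c * (d + 1) * K ^ j"
    using c_pos K_ge_1(2)[of j] by (intro add_mono mult_left_mono Suc.IH) auto
  also have "\<dots> \<le> K ^ Suc j"
    using c_pos K_ge_1(2)[of j] by (simp add: K_def algebra_simps)
  finally show ?case by simp
qed

text \<open>Union bound over the ordered pairs of distinct facets.\<close>

lemma Pr_cyc_le:
  assumes "\<tau> \<in> E"
  shows "Pr (\<lambda>F. cyc d j F \<tau>) \<le> (d + 1)\<^sup>2 * (K ^ j / n)"
proof -
  have fac: "facets d \<tau> \<subseteq> faces" using facets_dsimplex[OF assms] by auto
  have fin: "finite (facets d \<tau>)" using fac finite_faces by (rule finite_subset)
  have "Pr (\<lambda>F. cyc d j F \<tau>) \<le> (\<Sum>\<rho>\<in>facets d \<tau>. Pr (\<lambda>F. \<exists>\<rho>'\<in>facets d \<tau> - {\<rho>}. \<rho>' \<in> nb d F j \<rho>))"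
    unfolding cyc_def by (rule Pr_bex_le[OF fin])
  also have "\<dots> \<le> (\<Sum>\<rho>\<in>facets d \<tau>. \<Sum>\<rho>'\<in>facets d \<tau> - {\<rho>}. reach j \<rho> \<rho>')"
    unfolding reach_def using fin by (intro sum_mono Pr_bex_le) auto
  also have "\<dots> \<le> (\<Sum>\<rho>\<in>facets d \<tau>. \<Sum>\<rho>'\<in>facets d \<tau> - {\<rho>}. K ^ j / n)"
    using fac by (intro sum_mono reach_le) auto
  also have "\<dots> \<le> (\<Sum>\<rho>\<in>facets d \<tau>. (d + 1) * (K ^ j / n))"
  proof (rule sum_mono)
    fix \<rho>
    have "card (facets d \<tau> - {\<rho>}) \<le> d + 1"
      using card_mono[OF fin, of "facets d \<tau> - {\<rho>}"] card_facets[OF assms] by auto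
    then show "(\<Sum>\<rho>'\<in>facets d \<tau> - {\<rho>}. K ^ j / n) \<le> (d + 1) * (K ^ j / n)"
      unfolding sum_constant using K_ge_1(2)[of j]
      by (intro mult_right_mono) (auto simp: of_nat_mono)
  qed
  also have "\<dots> = (d + 1)\<^sup>2 * (K ^ j / n)"
    using card_facets[OF assms] n_pos by (simp add: power2_eq_square field_simps)
  finally show ?thesis .
qed

section \<open>Near-independence of survival at different faces\<close>

text \<open>Reveal the simplices met by the explorations from \<open>A\<close> and resample the others. Simplices
  found absent can only hurt the survival of \<open>\<sigma>\<close>, those found present matter only
  if the exploration of \<open>\<sigma>\<close> in the independent copy meets them.\<close>

lemma Pr_surv_insert_le:
  assumes "A \<subseteq> faces" "\<sigma> \<in> faces - A"
  shows "Pr (\<lambda>F. (\<forall>a\<in>A. surv d k F a) \<and> surv d k F \<sigma>)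
      \<le> Pr (\<lambda>F. \<forall>a\<in>A. surv d k F a) * Pr (\<lambda>F. surv d k F \<sigma>)
        + (\<Sum>a\<in>A. \<Sum>\<rho>\<in>faces. reach (Suc k) a \<rho> * reach k \<sigma> \<rho>)"
proof -
  define C where "C F = (\<Union>a\<in>A. touch d F k a)" for F
  define f :: "nat set set \<Rightarrow> real" where "f F = of_bool (\<forall>a\<in>A. surv d k F a)" for F
  define g :: "nat set set \<Rightarrow> real" where "g F = of_bool (surv d k F \<sigma>)" for F
  define r :: "nat \<Rightarrow> nat set \<Rightarrow> nat set \<Rightarrow> nat set set \<Rightarrow> real"
    where "r j a \<rho> F = of_bool (\<rho> \<in> nb d F j a)" for j a \<rho> F
  have finA: "finite A" using assms(1) finite_faces by (rule finite_subset)
  have agree: "F \<inter> touch d F k a = G \<inter> touch d F k a" if "F \<inter> C F = G \<inter> C F" "a \<in> A" for F G a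
    using that unfolding C_def by blast
  have stop: "C G = C F" if "F \<inter> C F = G \<inter> C F" for F G
    unfolding C_def using touch_local[OF agree[OF that]] by simp
  have key: "f ((F \<inter> C F) \<union> (G - C F)) * g ((F \<inter> C F) \<union> (G - C F))
      \<le> f F * g G + (\<Sum>a\<in>A. \<Sum>\<rho>\<in>faces. r (Suc k) a \<rho> F * r k \<sigma> \<rho> G)"
    if F: "F \<subseteq> E" "G \<subseteq> E" for F G
  proof -
    let ?H = "(F \<inter> C F) \<union> (G - C F)"
    let ?R = "\<Sum>a\<in>A. \<Sum>\<rho>\<in>faces. r (Suc k) a \<rho> F * r k \<sigma> \<rho> G"
    have R0: "0 \<le> ?R" by (intro sum_nonneg) (simp add: r_def)
    have "F \<inter> C F = ?H \<inter> C F" by blast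
    from surv_local[OF agree[OF this]] have fH: "f ?H = f F" by (simp add: f_def)
    show ?thesis
    proof (cases "surv d k ?H \<sigma> \<and> \<not> surv d k G \<sigma>")
      case False
      then have "g ?H \<le> g G" by (auto simp: g_def)
      then have "f F * g ?H \<le> f F * g G" by (intro mult_left_mono) (auto simp: f_def)
      then show ?thesis using R0 fH by simp
    next
      case True
      \<comment> \<open>By monotonicity \<open>\<sigma>\<close> survives in \<open>?U\<close>, which
        differs from \<open>G\<close> only by simplices of \<open>F\<close> inspected from
        \<open>A\<close>. Survival in \<open>?U\<close> but not in \<open>G\<close> means that the
        exploration of \<open>\<sigma>\<close> in \<open>G\<close> touches one of them.\<close>
      let ?U = "(F \<inter> C F) \<union> G"
      have "surv d k ?U \<sigma>" using True by (auto intro: surv_mono[of ?H ?U])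
      then have "G \<inter> touch d G k \<sigma> \<noteq> ?U \<inter> touch d G k \<sigma>"
        using surv_local[of G d k \<sigma> ?U] True by blast
      then obtain \<tau> where "\<tau> \<in> F" "\<tau> \<in> C F" "\<tau> \<in> touch d G k \<sigma>" by blast
      then obtain a \<rho>1 \<rho> where h: "\<tau> \<in> F" "a \<in> A" "\<rho>1 \<in> nb d F k a" "\<rho>1 \<subseteq> \<tau>"
        "\<rho> \<in> nb d G k \<sigma>" "\<rho> \<subseteq> \<tau>"
        unfolding C_def touch_def by blast
      have \<rho>: "\<rho> \<in> faces" using nb_subset_faces[OF F(2), of \<sigma> k] assms(2) h(5) by blast
      \<comment> \<open>As \<open>\<tau>\<close> is present in \<open>F\<close>, one more move
        through it reaches \<open>\<rho>\<close>; hence radius \<open>Suc k\<close> from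
        \<open>a\<close> but only \<open>k\<close> from \<open>\<sigma>\<close>.\<close>
      then have "\<rho> \<in> nb d F (Suc k) a" using h unfolding nb.simps facets_def by blast
      then have "r (Suc k) a \<rho> F * r k \<sigma> \<rho> G = 1" using h(5) by (simp only: r_def) simp
      then have "1 \<le> (\<Sum>\<rho>\<in>faces. r (Suc k) a \<rho> F * r k \<sigma> \<rho> G)"
        using member_le_sum[OF \<rho>, of "\<lambda>\<rho>. r (Suc k) a \<rho> F * r k \<sigma> \<rho> G"] finite_faces
        by (simp add: r_def)
      also have "\<dots> \<le> ?R"
        using member_le_sum[OF h(2), of "\<lambda>a. \<Sum>\<rho>\<in>faces. r (Suc k) a \<rho> F * r k \<sigma> \<rho> G"] finA
        by (simp add: r_def sum_nonneg)
      finally have "1 \<le> ?R" .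
      moreover have "f ?H * g ?H \<le> 1" "0 \<le> f F * g G" by (simp_all add: f_def g_def)
      ultimately show ?thesis by linarith
    qed
  qed
  have "Pr (\<lambda>F. (\<forall>a\<in>A. surv d k F a) \<and> surv d k F \<sigma>) = bexp E p (\<lambda>F. f F * g F)"
    by (simp add: Pr_def f_def g_def of_bool_conj)
  also have "\<dots> = bexp E p (\<lambda>F. bexp E p (\<lambda>G.
      f ((F \<inter> C F) \<union> (G - C F)) * g ((F \<inter> C F) \<union> (G - C F))))"
    by (rule bexp_resample[OF finite_dsimplices stop])
  also have "\<dots> \<le> bexp E p (\<lambda>F. bexp E p (\<lambda>G.
      f F * g G + (\<Sum>a\<in>A. \<Sum>\<rho>\<in>faces. r (Suc k) a \<rho> F * r k \<sigma> \<rho> G)))"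
    using p_bounds key by (intro bexp_mono) auto
  also have "\<dots> = bexp E p f * bexp E p g
      + (\<Sum>a\<in>A. \<Sum>\<rho>\<in>faces. bexp E p (r (Suc k) a \<rho>) * bexp E p (r k \<sigma> \<rho>))"
    by (simp only: bexp_add bexp_sum bexp_cmult bexp_multc)
  finally show ?thesis
    by (simp add: Pr_def reach_def f_def[abs_def] g_def[abs_def] r_def[abs_def] del: nb.simps)
qed

text \<open>At \<open>\<rho> = \<sigma>\<close> the first factor is of order \<open>1 / n\<close>.
  Elsewhere the second one is, and the first factors sum to at most the bound on the expected ball
  size.\<close>

lemma sum_reach_reach_le:
  assumes "a \<in> faces" "\<sigma> \<in> faces" "a \<noteq> \<sigma>"
  shows "(\<Sum>\<rho>\<in>faces. reach (Suc k) a \<rho> * reach k \<sigma> \<rho>) \<le> 2 * K ^ (2 * k + 1) / n"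
proof -
  have Kp: "K ^ (2 * k + 1) = K ^ Suc k * K ^ k"
    by (simp add: power_add mult_2)
  have "(\<Sum>\<rho>\<in>faces. reach (Suc k) a \<rho> * reach k \<sigma> \<rho>)
      = reach (Suc k) a \<sigma> * reach k \<sigma> \<sigma> + (\<Sum>\<rho>\<in>faces - {\<sigma>}. reach (Suc k) a \<rho> * reach k \<sigma> \<rho>)"
    using finite_faces assms(2) by (rule sum.remove)
  also have "\<dots> \<le> K ^ Suc k / n * 1 + (\<Sum>\<rho>\<in>faces - {\<sigma>}. reach (Suc k) a \<rho> * (K ^ k / n))"
    using assms K_ge_1 Pr_le_1[of "\<lambda>F. \<sigma> \<in> nb d F k \<sigma>"]
    by (intro add_mono mult_mono sum_mono reach_le order_refl) (auto simp: reach_nonneg reach_def[of k \<sigma> \<sigma>] Pr_nonneg)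
  also have "\<dots> \<le> K ^ Suc k / n * K ^ k + K ^ Suc k * (K ^ k / n)"
  proof (intro add_mono mult_left_mono)
    have "(\<Sum>\<rho>\<in>faces - {\<sigma>}. reach (Suc k) a \<rho> * (K ^ k / n))
        \<le> (\<Sum>\<rho>\<in>faces. reach (Suc k) a \<rho>) * (K ^ k / n)"
      unfolding sum_distrib_right using finite_faces K_ge_1(2)[of k]
      by (intro sum_mono2) (auto simp: reach_nonneg)
    also have "\<dots> \<le> K ^ Suc k * (K ^ k / n)"
      using K_ge_1(2)[of k] assms by (intro mult_right_mono sum_reach_le) auto
    finally show "(\<Sum>\<rho>\<in>faces - {\<sigma>}. reach (Suc k) a \<rho> * (K ^ k / n)) \<le> K ^ Suc k * (K ^ k / n)" .
    show "0 \<le> K ^ Suc k / n" using K_ge_1(2)[of "Suc k"] by (intro divide_nonneg_nonneg) auto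
  qed (rule K_ge_1(2))
  also have "\<dots> = 2 * K ^ (2 * k + 1) / n" unfolding Kp by simp
  finally show ?thesis .
qed

text \<open>Faces are added one at a time. Adding one to \<open>m\<close> faces costs
  \<open>m\<close> error terms, and \<open>m\<^sup>2 + m \<le> (m + 1)\<^sup>2\<close>.\<close>

lemma Pr_surv_all_le:
  assumes "finite A" "A \<subseteq> faces" "0 \<le> u" "u \<le> 1"
    and "\<And>\<sigma>. \<sigma> \<in> A \<Longrightarrow> Pr (\<lambda>F. surv d k F \<sigma>) \<le> u"
  shows "Pr (\<lambda>F. \<forall>a\<in>A. surv d k F a) \<le> u ^ card A + (real (card A))\<^sup>2 * (2 * K ^ (2 * k + 1) / n)"
  using assms(1,2,5)
proof (induction A)
  case empty
  then show ?case by (simp add: Pr_le_1)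
next
  case (insert \<sigma> A)
  define b where "b = 2 * K ^ (2 * k + 1) / n"
  define m where "m = real (card A)"
  have b: "0 \<le> b" using K_ge_1(2)[of "2 * k + 1"] by (simp add: b_def)
  have "Pr (\<lambda>F. \<forall>a\<in>insert \<sigma> A. surv d k F a) = Pr (\<lambda>F. (\<forall>a\<in>A. surv d k F a) \<and> surv d k F \<sigma>)"
    by (rule arg_cong[of _ _ Pr]) auto
  also have "\<dots> \<le> Pr (\<lambda>F. \<forall>a\<in>A. surv d k F a) * Pr (\<lambda>F. surv d k F \<sigma>)
        + (\<Sum>a\<in>A. \<Sum>\<rho>\<in>faces. reach (Suc k) a \<rho> * reach k \<sigma> \<rho>)"
    using insert by (intro Pr_surv_insert_le) auto
  also have "\<dots> \<le> (u ^ card A + m\<^sup>2 * b) * u + (\<Sum>a\<in>A. b)"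
  proof (intro add_mono mult_mono sum_mono)
    show "Pr (\<lambda>F. \<forall>a\<in>A. surv d k F a) \<le> u ^ card A + m\<^sup>2 * b"
      unfolding b_def m_def using insert.prems by (intro insert.IH) auto
    show "0 \<le> u ^ card A + m\<^sup>2 * b" using assms(3) b by simp
    fix a assume "a \<in> A"
    then show "(\<Sum>\<rho>\<in>faces. reach (Suc k) a \<rho> * reach k \<sigma> \<rho>) \<le> b"
      unfolding b_def using insert by (intro sum_reach_reach_le) auto
  qed (use insert.prems in \<open>auto simp: Pr_nonneg\<close>)
  also have "\<dots> = u ^ Suc (card A) + (m\<^sup>2 * b) * u + m * b"
    by (simp add: m_def algebra_simps)
  also have "\<dots> \<le> u ^ Suc (card A) + (m\<^sup>2 * b) * 1 + m * b"
    using b assms(4) by (intro add_mono mult_left_mono order_refl) auto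
  also have "\<dots> \<le> u ^ Suc (card A) + (m + 1)\<^sup>2 * b"
    using b by (simp add: m_def power2_eq_square algebra_simps)
  finally show ?case using insert.hyps by (simp add: m_def b_def algebra_simps)
qed

section \<open>The recursion for the survival probability\<close>

text \<open>Numerator of the error of order \<open>1 / n\<close>: the first summand accounts for
  cycles, the second for the dependence between the \<open>d\<close> further facets of a coface. It
  does not involve \<open>n\<close>.\<close>

definition err :: "nat \<Rightarrow> real" where
  "err k = ((d + 1)\<^sup>2 * K ^ k + d\<^sup>2 * (2 * K ^ (2 * k + 1)))"

lemma err_nonneg: "0 \<le> err k"
  using K_ge_1 by (simp add: err_def)

lemma Pr_branch_le:
  assumes "\<tau> \<in> E" "\<sigma> \<in> facets d \<tau>" "0 \<le> u" "u \<le> 1"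
    and "\<And>\<sigma>'. \<sigma>' \<in> faces \<Longrightarrow> Pr (\<lambda>F. surv d k F \<sigma>') \<le> u"
  shows "Pr (\<lambda>F. cyc d k F \<tau> \<or> (\<forall>\<sigma>'\<in>facets d \<tau> - {\<sigma>}. surv d k F \<sigma>')) \<le> u ^ d + err k / n"
proof -
  have fac: "facets d \<tau> - {\<sigma>} \<subseteq> faces" using facets_dsimplex[OF assms(1)] by auto
  have fin: "finite (facets d \<tau>)"
    using facets_dsimplex[OF assms(1)] finite_faces by simp
  have card: "card (facets d \<tau> - {\<sigma>}) = d"
    using card_facets[OF assms(1)] assms(2) fin by simp
  have "Pr (\<lambda>F. cyc d k F \<tau> \<or> (\<forall>\<sigma>'\<in>facets d \<tau> - {\<sigma>}. surv d k F \<sigma>'))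
      \<le> Pr (\<lambda>F. cyc d k F \<tau>) + Pr (\<lambda>F. \<forall>\<sigma>'\<in>facets d \<tau> - {\<sigma>}. surv d k F \<sigma>')"
    by (rule Pr_disj_le)
  also have "\<dots> \<le> (d + 1)\<^sup>2 * (K ^ k / n) + (u ^ d + d\<^sup>2 * (2 * K ^ (2 * k + 1) / n))"
    using Pr_surv_all_le[OF _ fac assms(3,4,5)] Pr_cyc_le[OF assms(1)] fac fin
    by (intro add_mono) (auto simp: card)
  also have "\<dots> = u ^ d + err k / n"
    by (simp add: err_def add_divide_distrib)
  finally show ?thesis .
qed

text \<open>Failure at \<open>\<sigma>\<close> is the conjunction of the decreasing events
  \<open>\<not> Y \<tau>\<close> over all cofaces. Harris' inequality bounds its probability below
  by a product of at most \<open>n\<close> factors, each at least \<open>L\<close>.\<close>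

lemma Pr_surv_Suc_le:
  assumes "\<sigma> \<in> faces" "0 \<le> u" "u \<le> 1"
    and "\<And>\<sigma>'. \<sigma>' \<in> faces \<Longrightarrow> Pr (\<lambda>F. surv d k F \<sigma>') \<le> u"
  shows "Pr (\<lambda>F. surv d (Suc k) F \<sigma>) \<le> 1 - exp (- (c * (u ^ d + err k / n)) / (1 - p))"
proof -
  let ?S = "{\<tau>\<in>E. \<sigma> \<subseteq> \<tau>}"
  define X where "X \<tau> = (\<lambda>F. cyc d k F \<tau> \<or> (\<forall>\<sigma>'\<in>facets d \<tau> - {\<sigma>}. surv d k F \<sigma>'))" for \<tau>
  define Y where "Y \<tau> = (\<lambda>F. \<tau> \<in> F \<and> X \<tau> (F - {\<tau>}))" for \<tau>
  define L where "L = exp (- (p * (u ^ d + err k / n)) / (1 - p))"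
  have finS: "finite ?S" by (simp add: finite_dsimplices)
  have X_mono: "X \<tau> G" if "F \<subseteq> G" "X \<tau> F" for \<tau> F G
    using that(2) unfolding X_def
    by (elim disjE) (simp_all add: cyc_mono[OF that(1)] surv_mono[OF that(1)])
  have Y_mono: "Y \<tau> G" if "F \<subseteq> G" "Y \<tau> F" for \<tau> F G
    using that(2) subsetD[OF that(1)] X_mono[OF Diff_mono[OF that(1) order_refl, of "{\<tau>}"], of \<tau>]
    unfolding Y_def by simp
  have PY: "L \<le> 1 - Pr (Y \<tau>)" if \<tau>: "\<tau> \<in> ?S" for \<tau>
  proof -
    have "\<sigma> \<in> facets d \<tau>" using \<tau> assms(1) by (simp add: facets_def)
    then have PX: "Pr (X \<tau>) \<le> u ^ d + err k / n"
      unfolding X_def using \<tau> by (intro Pr_branch_le assms) simp_all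
    have PYX: "Pr (Y \<tau>) \<le> p * Pr (X \<tau>)"
      unfolding Y_def using \<tau> by (intro Pr_present_le) (simp, rule X_mono)
    define t where "t = Pr (Y \<tau>)"
    have t: "0 \<le> t" "t \<le> p" "t < 1" "t \<le> p * (u ^ d + err k / n)"
      using PYX mult_left_mono[OF PX p_bounds(3)] mult_left_mono[OF Pr_le_1[of "X \<tau>"] p_bounds(3)]
        p_bounds(2) Pr_nonneg[of "Y \<tau>"] unfolding t_def mult_1_right by linarith+
    \<comment> \<open>This is \<open>1 + s \<le> exp s\<close> at \<open>s = t / (1 - t)\<close>;
      inverting it bounds \<open>1 - t\<close> below by an exponential. The denominator becomes
      \<open>1 - p\<close> through \<open>t \<le> p\<close>.\<close>
    have "1 / (1 - t) \<le> exp (t / (1 - t))"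
      using exp_ge_add_one_self[of "t / (1 - t)"] t by (simp add: field_simps)
    then have "exp (- (t / (1 - t))) \<le> 1 - t"
      using t by (simp add: exp_minus field_simps)
    moreover have "t / (1 - t) \<le> p * (u ^ d + err k / n) / (1 - p)"
      using t p_bounds by (intro frac_le) auto
    ultimately show ?thesis unfolding L_def t_def[symmetric]
      by (simp add: order_trans[rotated])
  qed
  \<comment> \<open>\<open>L \<le> 1\<close>, so replacing the number of cofaces by \<open>n\<close>
    only decreases the power and turns \<open>n * p\<close> into \<open>c\<close>.\<close>
  have "L ^ n \<le> L ^ card ?S"
    using card_cofaces[OF assms(1)] p_bounds err_nonneg[of k] assms(2)
    by (intro power_decreasing) (auto simp: L_def)
  also have "\<dots> = (\<Prod>\<tau>\<in>?S. L)" by simp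
  also have "\<dots> \<le> (\<Prod>\<tau>\<in>?S. 1 - Pr (Y \<tau>))"
    using PY by (intro prod_mono) (auto simp: L_def)
  also have "\<dots> = (\<Prod>\<tau>\<in>?S. bexp E p (\<lambda>F. of_bool (\<not> Y \<tau> F)))"
    by (simp add: Pr_def of_bool_not_iff bexp_diff bexp_const finite_dsimplices)
  also have "\<dots> \<le> bexp E p (\<lambda>F. \<Prod>\<tau>\<in>?S. of_bool (\<not> Y \<tau> F))"
  proof (rule harris_prod[OF finite_dsimplices p_bounds(3,4) finS])
    fix \<tau> and F G :: "nat set set" assume "F \<subseteq> G"
    then show "of_bool (\<not> Y \<tau> G) \<le> (of_bool (\<not> Y \<tau> F) :: real)" using Y_mono[of F G \<tau>] by auto
  qed simp
  also have "\<dots> = bexp E p (\<lambda>F. 1 - of_bool (surv d (Suc k) F \<sigma>))"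
  proof (rule bexp_cong)
    fix F assume "F \<subseteq> E"
    moreover have "surv d (Suc k) F \<sigma> \<longleftrightarrow> (\<exists>\<tau>\<in>F. \<sigma> \<subseteq> \<tau> \<and> X \<tau> (F - {\<tau>}))"
      by (simp add: X_def)
    ultimately have "surv d (Suc k) F \<sigma> \<longleftrightarrow> (\<exists>\<tau>\<in>?S. Y \<tau> F)"
      unfolding Y_def by blast
    then show "(\<Prod>\<tau>\<in>?S. of_bool (\<not> Y \<tau> F)) = (1 - of_bool (surv d (Suc k) F \<sigma>) :: real)"
      using finS by (cases "surv d (Suc k) F \<sigma>") (auto simp del: surv.simps)
  qed
  also have "\<dots> = 1 - Pr (\<lambda>F. surv d (Suc k) F \<sigma>)"
    unfolding Pr_def by (simp add: bexp_diff bexp_const finite_dsimplices del: surv.simps)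
  also have "L ^ n = exp (- (c * (u ^ d + err k / n)) / (1 - p))"
    unfolding L_def exp_of_nat_mult[symmetric]
    by (simp only: mult_minus_right times_divide_eq_right mult.assoc[symmetric] n_p)
  finally show ?thesis by simp
qed

text \<open>The tree at one arbitrary facet is enough; the presence of \<open>\<tau>\<close> is
  independent of it and gives the factor \<open>p\<close>.\<close>

lemma Pr_survivor_le:
  assumes "\<tau> \<in> E" and "\<And>\<sigma>. \<sigma> \<in> faces \<Longrightarrow> Pr (\<lambda>F. surv d k F \<sigma>) \<le> u"
  shows "Pr (\<lambda>F. \<tau> \<in> (collapse_step d ^^ k) F) \<le> p * (u + err k / n)"
proof -
  have "facets d \<tau> \<noteq> {}" using card_facets[OF assms(1)] by auto
  then obtain \<sigma> where \<sigma>: "\<sigma> \<in> facets d \<tau>" by blast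
  have "Pr (\<lambda>F. \<tau> \<in> (collapse_step d ^^ k) F)
      \<le> Pr (\<lambda>F. \<tau> \<in> F \<and> (cyc d k (F - {\<tau>}) \<tau> \<or> surv d k (F - {\<tau>}) \<sigma>))"
    using surv_if_not_collapsed[OF _ \<sigma>] collapse_subset by (intro Pr_mono) blast
  also have "\<dots> \<le> p * Pr (\<lambda>F. cyc d k F \<tau> \<or> surv d k F \<sigma>)"
    using cyc_mono surv_mono
    by (intro Pr_present_le[where P = "\<lambda>F. cyc d k F \<tau> \<or> surv d k F \<sigma>"] assms(1)) metis
  also have "\<dots> \<le> p * (u + err k / n)"
  proof (rule mult_left_mono)
    have "Pr (\<lambda>F. cyc d k F \<tau> \<or> surv d k F \<sigma>) \<le> Pr (\<lambda>F. cyc d k F \<tau>) + Pr (\<lambda>F. surv d k F \<sigma>)"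
      by (rule Pr_disj_le)
    also have "\<dots> \<le> (d + 1)\<^sup>2 * (K ^ k / n) + u"
      using \<sigma> facets_dsimplex[OF assms(1)] by (intro add_mono Pr_cyc_le assms) auto
    also have "\<dots> \<le> u + err k / n"
      using K_ge_1(2)[of "2 * k + 1"] by (simp add: err_def add_divide_distrib)
    finally show "Pr (\<lambda>F. cyc d k F \<tau> \<or> surv d k F \<sigma>) \<le> u + err k / n" .
  qed (rule p_bounds)
  finally show ?thesis .
qed

section \<open>Markov bound for the stable complex\<close>

lemma card_E_le: "real (card E) \<le> real n ^ Suc d"
proof -
  have "card E = n choose Suc d"
    using n_subsets[of "{1..n}" "Suc d"] by (simp add: dsimplices_def)
  then have "card E \<le> n ^ Suc d" using binomial_le_pow[of "Suc d" n]
    by (cases "Suc d \<le> n") (simp_all add: binomial_eq_0)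
  then have "real (card E) \<le> real (n ^ Suc d)" by (simp only: of_nat_le_iff)
  then show ?thesis by simp
qed

lemma prob_Yd_eq_Pr: "prob_Yd n d (c / n) P = Pr P"
  unfolding prob_Yd_def Pr_def bexp_def p_def[symmetric]
proof (rule sum.cong)
  fix F assume "F \<in> Pow E"
  then have F: "F \<subseteq> E" by simp
  have "(\<Prod>e\<in>E. if e \<in> F then p else 1 - p) = p ^ card (E \<inter> F) * (1 - p) ^ card (E - F)"
    by (simp add: prod.If_cases finite_dsimplices Collect_neg_eq Diff_eq)
  also have "E \<inter> F = F" using F by blast
  also have "card (E - F) = card E - card F"
    using F finite_dsimplices by (intro card_Diff_subset) (auto intro: finite_subset)
  finally show "(if P F then p ^ card F * (1 - p) ^ (card E - card F) else 0)
      = (\<Prod>e\<in>E. if e \<in> F then p else 1 - p) * of_bool (P F)" by simp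
qed simp

text \<open>Markov's inequality for the number of simplices left after \<open>k\<close> rounds,
  which bounds that of \<open>R_inf\<close>. There are at most \<open>n ^ Suc d\<close> candidates
  and \<open>n * p = c\<close>, so \<open>n ^ d\<close> cancels.\<close>

lemma Pr_R_inf_le:
  assumes "0 < \<delta>" "0 \<le> u" and "\<And>\<sigma>. \<sigma> \<in> faces \<Longrightarrow> Pr (\<lambda>F. surv d k F \<sigma>) \<le> u"
  shows "Pr (\<lambda>F. real (card (R_inf d F)) > \<delta> * real n ^ d) \<le> c / \<delta> * (u + err k / n)"
proof -
  have nd: "0 < \<delta> * real n ^ d" using assms n_pos by simp
  have "Pr (\<lambda>F. real (card (R_inf d F)) > \<delta> * real n ^ d)
      \<le> bexp E p (\<lambda>F. (\<Sum>\<tau>\<in>E. of_bool (\<tau> \<in> (collapse_step d ^^ k) F)) * (1 / (\<delta> * real n ^ d)))"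
    unfolding Pr_def
  proof (rule bexp_mono)
    fix F assume F: "F \<subseteq> E"
    let ?R = "(collapse_step d ^^ k) F"
    have R: "?R \<subseteq> E" using F collapse_subset by blast
    have "card (R_inf d F) \<le> card ?R"
      using R finite_dsimplices by (intro card_mono) (auto simp: R_inf_def intro: finite_subset)
    moreover have "(\<Sum>\<tau>\<in>E. of_bool (\<tau> \<in> ?R)) = real (card ?R)"
      using R finite_dsimplices by (simp add: of_bool_def sum.If_cases Int_absorb1)
    ultimately show "of_bool (\<delta> * real n ^ d < real (card (R_inf d F)))
        \<le> (\<Sum>\<tau>\<in>E. of_bool (\<tau> \<in> ?R)) * (1 / (\<delta> * real n ^ d))"
      using nd by (auto simp: of_bool_def field_simps)
  qed (rule p_bounds)+
  also have "\<dots> = (\<Sum>\<tau>\<in>E. Pr (\<lambda>F. \<tau> \<in> (collapse_step d ^^ k) F)) * (1 / (\<delta> * real n ^ d))"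
    by (simp only: bexp_multc bexp_sum Pr_def)
  also have "\<dots> \<le> (real n ^ Suc d * (p * (u + err k / n))) * (1 / (\<delta> * real n ^ d))"
  proof (rule mult_right_mono)
    have "(\<Sum>\<tau>\<in>E. Pr (\<lambda>F. \<tau> \<in> (collapse_step d ^^ k) F)) \<le> card E * (p * (u + err k / n))"
      using assms(3) by (intro sum_bounded_above Pr_survivor_le) auto
    also have "\<dots> \<le> real n ^ Suc d * (p * (u + err k / n))"
      using card_E_le p_bounds assms(2) err_nonneg[of k] by (intro mult_right_mono) auto
    finally show "(\<Sum>\<tau>\<in>E. Pr (\<lambda>F. \<tau> \<in> (collapse_step d ^^ k) F))
        \<le> real n ^ Suc d * (p * (u + err k / n))" .
  qed (use nd in simp)
  also have "\<dots> = c / \<delta> * (u + err k / n)"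
    using n_pos assms(1) unfolding p_def by (simp add: field_simps)
  finally show ?thesis .
qed

end

section \<open>The limit\<close>

fun qseq :: "nat \<Rightarrow> real \<Rightarrow> nat \<Rightarrow> real" where
  "qseq d c 0 = 1"
| "qseq d c (Suc k) = 1 - exp (- c * qseq d c k ^ d)"

lemma qseq_bounds:
  assumes "0 < c"
  shows "0 \<le> qseq d c k" "qseq d c k \<le> 1"
proof -
  have "0 \<le> qseq d c k \<and> qseq d c k \<le> 1"
    using assms by (induction k) auto
  then show "0 \<le> qseq d c k" "qseq d c k \<le> 1" by auto
qed

text \<open>The iterated map is increasing, so the initial step down from the maximal value 1
  propagates.\<close>

lemma qseq_decseq:
  assumes "0 < c"
  shows "decseq (qseq d c)"
proof (rule decseq_SucI)
  fix k show "qseq d c (Suc k) \<le> qseq d c k"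
  proof (induction k)
    case (Suc k)
    then have "qseq d c (Suc k) ^ d \<le> qseq d c k ^ d"
      by (rule power_mono) (rule qseq_bounds[OF assms])
    then show ?case using assms by (simp add: mult_left_mono)
  qed simp
qed

text \<open>Otherwise \<open>c\<close> itself would belong to the set whose infimum is
  \<open>gamma_d d\<close>.\<close>

lemma no_fixed_point_below_gamma:
  assumes "0 < c" "c < gamma_d d" "x < 1"
  shows "exp (- c * (1 - x) ^ d) \<noteq> x"
proof
  assume "exp (- c * (1 - x) ^ d) = x"
  then have "gamma_d d \<le> c"
    unfolding gamma_d_def using assms by (intro cInf_lower bdd_belowI[of _ 0]) auto
  then show False using assms by simp
qed

lemma qseq_tendsto_0:
  assumes "0 < c" "c < gamma_d d"
  shows "qseq d c \<longlonglongrightarrow> 0"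
proof -
  obtain q where q: "qseq d c \<longlonglongrightarrow> q" "\<And>k. q \<le> qseq d c k"
    using decseq_convergent[OF qseq_decseq[OF assms(1)], of 0] qseq_bounds[OF assms(1)] by blast
  have "0 \<le> q" using q(1) qseq_bounds(1)[OF assms(1)] by (intro LIMSEQ_le_const) auto
  have "(\<lambda>k. 1 - exp (- c * qseq d c k ^ d)) \<longlonglongrightarrow> 1 - exp (- c * q ^ d)"
    by (intro tendsto_intros q)
  moreover have "(\<lambda>k. qseq d c (Suc k)) \<longlonglongrightarrow> q"
    using q(1) by (rule LIMSEQ_Suc)
  ultimately have "q = 1 - exp (- c * q ^ d)"
    using LIMSEQ_unique by auto
  \<comment> \<open>With \<open>x = 1 - q\<close> the fixed point equation becomes the one defining
    \<open>gamma_d\<close>, and \<open>q > 0\<close> would give \<open>x < 1\<close>.\<close>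
  then have "exp (- c * (1 - (1 - q)) ^ d) = 1 - q" by simp
  then have "q = 0"
    using no_fixed_point_below_gamma[OF assms, of "1 - q"] \<open>0 \<le> q\<close> by (cases "q = 0") auto
  then show ?thesis using q(1) by simp
qed

text \<open>For fixed \<open>k\<close> the recursive bounds at finite \<open>n\<close> converge to
  the recursion of \<open>qseq\<close>. The bound \<open>u n\<close> is uniform over all faces and
  stays in the unit interval, as the next recursion step requires.\<close>

lemma ex_surv_bound:
  assumes "0 < c"
  shows "\<exists>u. u \<longlonglongrightarrow> qseq d c k \<and> (\<forall>n. c < real n \<longrightarrow> 0 \<le> u n \<and> u n \<le> 1 \<and>
      (\<forall>\<sigma>\<in>facets d {1..n}. linial_meshulam.Pr n d c (\<lambda>F. surv d k F \<sigma>) \<le> u n))"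
proof (induction k)
  case 0
  have "linial_meshulam.Pr n d c P \<le> 1" if "c < real n" for n P
    using linial_meshulam.Pr_le_1[OF linial_meshulam.intro[OF assms that]] .
  then show ?case by (intro exI[of _ "\<lambda>_. 1"]) auto
next
  case (Suc k)
  then obtain u where u: "u \<longlonglongrightarrow> qseq d c k" and u': "\<And>n. c < real n \<Longrightarrow> 0 \<le> u n \<and> u n \<le> 1 \<and>
      (\<forall>\<sigma>\<in>facets d {1..n}. linial_meshulam.Pr n d c (\<lambda>F. surv d k F \<sigma>) \<le> u n)"
    by blast
  \<comment> \<open>The parameter \<open>n\<close> does not occur in \<open>err\<close>, so
    \<open>B\<close> is a constant and \<open>B / n\<close> vanishes in the limit.\<close>
  define B where "B = linial_meshulam.err d c k"
  define v where "v n = 1 - exp (- (c * (u n ^ d + B / n)) / (1 - c / n))" for n :: nat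
  have "v \<longlonglongrightarrow> 1 - exp (- (c * (qseq d c k ^ d + 0)) / (1 - 0))"
    unfolding v_def by (intro tendsto_intros u lim_const_over_n) simp
  then have "v \<longlonglongrightarrow> qseq d c (Suc k)" by simp
  moreover have "0 \<le> v n \<and> v n \<le> 1 \<and>
      (\<forall>\<sigma>\<in>facets d {1..n}. linial_meshulam.Pr n d c (\<lambda>F. surv d (Suc k) F \<sigma>) \<le> v n)"
    if n: "c < real n" for n
  proof -
    interpret linial_meshulam n d c by unfold_locales (use assms n in auto)
    have un: "0 \<le> u n" "u n \<le> 1" "\<And>\<sigma>. \<sigma> \<in> faces \<Longrightarrow> Pr (\<lambda>F. surv d k F \<sigma>) \<le> u n"
      using u'[OF n] by auto
    have "0 \<le> v n"
      unfolding v_def using err_nonneg[of k] assms n un by (simp add: B_def)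
    moreover have "v n \<le> 1" by (simp add: v_def)
    moreover have "Pr (\<lambda>F. surv d (Suc k) F \<sigma>) \<le> v n" if "\<sigma> \<in> faces" for \<sigma>
      unfolding v_def B_def p_def[symmetric] using that un by (intro Pr_surv_Suc_le)
    ultimately show ?thesis by blast
  qed
  ultimately show ?case by blast
qed

theorem theorem8:
  fixes d :: nat and \<delta> c :: real
  assumes "d \<ge> 2" and "\<delta> > 0" and "0 < c" and "c < gamma_d d"
  shows "(\<lambda>n. prob_Yd n d (c / real n)
            (\<lambda>F. real (card (R_inf d F)) > \<delta> * real n ^ d)) \<longlonglongrightarrow> 0"
proof -
  let ?P = "\<lambda>n. prob_Yd n d (c / real n) (\<lambda>F. real (card (R_inf d F)) > \<delta> * real n ^ d)"
  have large: "\<forall>\<^sub>F n in sequentially. c < real n"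
    by (rule eventually_sequentiallyI[of "nat \<lfloor>c\<rfloor> + 1"]) linarith
  have nonneg: "\<forall>\<^sub>F n in sequentially. 0 \<le> ?P n"
    using large
  proof eventually_elim
    case (elim n)
    interpret linial_meshulam n d c by unfold_locales (use assms elim in auto)
    show ?case unfolding prob_Yd_eq_Pr by (rule Pr_nonneg)
  qed
  have small: "\<forall>\<^sub>F n in sequentially. ?P n < e" if "0 < e" for e
  proof -
    \<comment> \<open>The depth \<open>k\<close> is fixed first so that the limiting bound is below
      \<open>e\<close>; only then does \<open>n\<close> grow.\<close>
    have "(\<lambda>k. c / \<delta> * qseq d c k) \<longlonglongrightarrow> c / \<delta> * 0"
      using assms by (intro tendsto_intros qseq_tendsto_0)
    then have "\<forall>\<^sub>F k in sequentially. c / \<delta> * qseq d c k < e"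
      using that by (intro order_tendstoD) auto
    then obtain k where k: "c / \<delta> * qseq d c k < e"
      by (rule eventually_happens'[OF sequentially_bot, THEN exE])
    obtain u where u: "u \<longlonglongrightarrow> qseq d c k" and u': "\<And>n. c < real n \<Longrightarrow> 0 \<le> u n \<and> u n \<le> 1 \<and>
        (\<forall>\<sigma>\<in>facets d {1..n}. linial_meshulam.Pr n d c (\<lambda>F. surv d k F \<sigma>) \<le> u n)"
      using ex_surv_bound[OF assms(3)] by blast
    define B where "B = linial_meshulam.err d c k"
    have "(\<lambda>n. c / \<delta> * (u n + B / n)) \<longlonglongrightarrow> c / \<delta> * (qseq d c k + 0)"
      by (intro tendsto_intros u lim_const_over_n)
    then have "\<forall>\<^sub>F n in sequentially. c / \<delta> * (u n + B / n) < e"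
      using k by (intro order_tendstoD) auto
    with large show ?thesis
    proof eventually_elim
      case (elim n)
      interpret linial_meshulam n d c by unfold_locales (use assms elim in auto)
      have "?P n \<le> c / \<delta> * (u n + B / n)"
        unfolding prob_Yd_eq_Pr B_def using u'[OF elim(1)] assms(2) by (intro Pr_R_inf_le) auto
      then show ?case using elim(2) by simp
    qed
  qed
  show ?thesis
  proof (rule order_tendstoI)
    fix a :: real assume "a < 0"
    with nonneg show "\<forall>\<^sub>F n in sequentially. a < ?P n"
      by (auto elim: eventually_mono)
  qed (rule small)
qed

end
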